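(* Let $p\ge1$. The map $i:\mathcal I(2p)\to\mathcal J_p$, $i(\overline C)=(\Lambda,m,d)$, induces a bijection from the set $\widetilde{\mathcal I}(2p)$ of $\mathrm O(2p)$-adjoint orbits of invertible elements of $\mathfrak o(2p)$ onto $\mathcal J_p$.
   Context: $\mathbb C^{2p}$ carries its canonical non-degenerate symmetric bilinear form $B$: for the canonical basis $\{E_1,\dots,E_p,F_1,\dots,F_p\}$, $B(E_i,F_j)=\delta_{ij}$ and $B(E_i,E_j)=B(F_i,F_j)=0$. $\mathrm O(2p)$ is its isometry group, $\mathfrak o(2p)$ the Lie algebra of $B$-skew-symmetric maps, with adjoint action $U\cdot C=UCU^{-1}$. $\mathcal I(2p)$ is the set of invertible elements of $\mathfrak o(2p)$. $\mathbb N^*$ denotes the positive integers. Let $\mathcal D=\bigcup_{r\in\mathbb N^*}\{(d_1,\dots,d_r)\in\mathbb N^r\mid d_1\ge d_2\ge\dots\ge d_r\ge1\}$ and $\Phi:\mathcal D\to\mathbb N$, $\Phi(d_1,\dots,d_r)=\sum_{i=1}^r d_i$. $\mathcal J_p$ is the set of all triples $(\Lambda,m,d)$ such that: (1) $\Lambda\subset\mathbb C\setminus\{0\}$ has at most $2p$ elements and $\lambda\in\Lambda$ if and only if $-\lambda\in\Lambda$; (2) $m:\Lambda\to\mathbb N^*$ satisfies $m(\lambda)=m(-\lambda)$ for all $\lambda\in\Lambda$ and $\sum_{\lambda\in\Lambda}m(\lambda)=2p$; (3) $d:\Lambda\to\mathcal D$ satisfies $d(\lambda)=d(-\lambda)$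 for all $\lambda\in\Lambda$ and $\Phi\circ d=m$. For $\overline C\in\mathcal I(2p)$, write $\overline C=S+N$ as the sum of its commuting semi-simple and nilpotent parts. Put $i(\overline C)=(\Lambda,m,d)$ where $\Lambda$ is the spectrum of $S$, $m(\lambda)$ is the multiplicity of $\lambda$, and $d(\lambda)$ is the decreasing list of sizes of the Jordan blocks of $N$ restricted to the eigenspace of $S$ for $\lambda$. This triple belongs to $\mathcal J_p$. *)

theory Defs
  imports
    "HOL-Library.FuncSet"
    "HOL-Algebra.Group_Action"
    "Jordan_Normal_Form.Jordan_Normal_Form"
    "Jordan_Normal_Form.Spectral_Radius"
begin

text \<open>
  Endomorphisms of \<open>\<complex>\<^sup>2\<^sup>p\<close> are matrices in \<open>carrier_mat (2*p) (2*p)\<close>. The canonical basis is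
  ordered \<open>E\<^sub>1,\<dots>,E\<^sub>p,F\<^sub>1,\<dots>,F\<^sub>p\<close>: coordinates \<open>0..<p\<close> are those of the \<open>E\<close>'s,
  coordinates \<open>p..<2*p\<close> those of the \<open>F\<close>'s.
\<close>

definition bform :: "nat \<Rightarrow> complex vec \<Rightarrow> complex vec \<Rightarrow> complex" where
  "bform p x y = (\<Sum>i<p. x $ i * y $ (p + i) + x $ (p + i) * y $ i)"

lemma bform_basis:
  assumes "i < p" "j < p"
  shows "bform p (unit_vec (2*p) i) (unit_vec (2*p) (p + j)) = (if i = j then 1 else 0)"
    and "bform p (unit_vec (2*p) i) (unit_vec (2*p) j) = 0"
    and "bform p (unit_vec (2*p) (p + i)) (unit_vec (2*p) (p + j)) = 0"
proof -
  have 1: "(\<Sum>k<p. if k = i \<and> k = j then 1 else 0 :: complex) = (if i = j then 1 else 0)"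
    using assms by (cases "i = j") (auto cong: conj_cong intro!: sum.neutral)
  show "bform p (unit_vec (2*p) i) (unit_vec (2*p) (p + j)) = (if i = j then 1 else 0)"
    unfolding 1[symmetric] bform_def using assms by (intro sum.cong) auto
qed (use assms in \<open>auto simp: bform_def intro!: sum.neutral\<close>)

definition orth_group :: "nat \<Rightarrow> complex mat monoid" where
  "orth_group p = \<lparr> carrier = {U \<in> carrier_mat (2*p) (2*p). invertible_mat U \<and>
      (\<forall>x\<in>carrier_vec (2*p). \<forall>y\<in>carrier_vec (2*p). bform p (U *\<^sub>v x) (U *\<^sub>v y) = bform p x y)},
     monoid.mult = (*), one = 1\<^sub>m (2*p) \<rparr>"

definition orth_lie_algebra :: "nat \<Rightarrow> complex mat set" where
  "orth_lie_algebra p = {C \<in> carrier_mat (2*p) (2*p).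
     \<forall>x\<in>carrier_vec (2*p). \<forall>y\<in>carrier_vec (2*p). bform p (C *\<^sub>v x) y = - bform p x (C *\<^sub>v y)}"

definition inv_skew :: "nat \<Rightarrow> complex mat set" where
  "inv_skew p = {C \<in> orth_lie_algebra p. invertible_mat C}"

definition adjoint_action :: "nat \<Rightarrow> complex mat \<Rightarrow> complex mat \<Rightarrow> complex mat" where
  "adjoint_action p U C = U * C * inv\<^bsub>orth_group p\<^esub> U"

definition semisimple_mat :: "complex mat \<Rightarrow> bool" where
  "semisimple_mat A \<longleftrightarrow> (\<exists>D. similar_mat A D \<and> diagonal_mat D)"

definition nilpotent_mat :: "complex mat \<Rightarrow> bool" where
  "nilpotent_mat A \<longleftrightarrow> (\<exists>k. A ^\<^sub>m k = 0\<^sub>m (dim_row A) (dim_row A))"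

definition jordan_decomposition :: "complex mat \<Rightarrow> complex mat \<times> complex mat" where
  "jordan_decomposition C = (let n = dim_row C in
     THE (S, N). S \<in> carrier_mat n n \<and> N \<in> carrier_mat n n \<and>
       C = S + N \<and> S * N = N * S \<and> semisimple_mat S \<and> nilpotent_mat N)"

definition eigenspace :: "complex mat \<Rightarrow> complex \<Rightarrow> complex vec set" where
  "eigenspace A \<mu> = {v \<in> carrier_vec (dim_row A). A *\<^sub>v v = \<mu> \<cdot>\<^sub>v v}"

text \<open>\<open>M\<close> is the matrix of the restriction of \<open>A\<close> to the \<open>A\<close>-invariant subspace \<open>W\<close> with
  respect to the basis of \<open>W\<close> formed by the columns of \<open>P\<close>.\<close>

definition restriction_matrix :: "complex mat \<Rightarrow> complex vec set \<Rightarrow> complex mat \<Rightarrow> bool" where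
  "restriction_matrix A W M \<longleftrightarrow> (let n = dim_row A in
     \<exists>k. \<exists>P\<in>carrier_mat n k. distinct (cols P) \<and>
       vectorspace.basis class_ring ((module_vec TYPE(complex) n)\<lparr>carrier := W\<rparr>) (set (cols P)) \<and>
       M \<in> carrier_mat k k \<and> A * P = P * M)"

text \<open>Intended for \<open>A\<close> nilpotent on \<open>W\<close>, so that only the eigenvalue \<open>0\<close> occurs.\<close>

definition block_sizes :: "complex mat \<Rightarrow> complex vec set \<Rightarrow> nat list" where
  "block_sizes A W = (THE ds. sorted_wrt (\<ge>) ds \<and>
     (\<exists>M. restriction_matrix A W M \<and> jordan_nf M (map (\<lambda>k. (k, 0)) ds)))"

definition partitions :: "nat list set" where
  "partitions = {ds. ds \<noteq> [] \<and> sorted_wrt (\<ge>) ds \<and> (\<forall>k\<in>set ds. k \<ge> 1)}"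

definition partition_sum :: "nat list \<Rightarrow> nat" where
  "partition_sum ds = sum_list ds"

text \<open>Functions with domain \<open>\<Lambda>\<close> are represented by extensional functions, so that equality of
  triples is equality of the functions on \<open>\<Lambda>\<close>.\<close>

definition index_set :: "nat \<Rightarrow> (complex set \<times> (complex \<Rightarrow> nat) \<times> (complex \<Rightarrow> nat list)) set" where
  "index_set p = {(\<Lambda>, m, d).
     (\<Lambda> \<subseteq> UNIV - {0} \<and> finite \<Lambda> \<and> card \<Lambda> \<le> 2*p \<and> (\<forall>\<mu>. \<mu> \<in> \<Lambda> \<longleftrightarrow> -\<mu> \<in> \<Lambda>)) \<and>
     (m \<in> \<Lambda> \<rightarrow>\<^sub>E {1..} \<and> (\<forall>\<mu>\<in>\<Lambda>. m \<mu> = m (-\<mu>)) \<and> (\<Sum>\<mu>\<in>\<Lambda>. m \<mu>) = 2*p) \<and>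
     (d \<in> \<Lambda> \<rightarrow>\<^sub>E partitions \<and> (\<forall>\<mu>\<in>\<Lambda>. d \<mu> = d (-\<mu>)) \<and> (\<forall>\<mu>\<in>\<Lambda>. partition_sum (d \<mu>) = m \<mu>))}"

definition jordan_triple :: "complex mat \<Rightarrow> complex set \<times> (complex \<Rightarrow> nat) \<times> (complex \<Rightarrow> nat list)" where
  "jordan_triple C = (let (S, N) = jordan_decomposition C; \<Lambda> = spectrum S in
     (\<Lambda>,
      restrict (\<lambda>\<mu>. Polynomial.order \<mu> (char_poly S)) \<Lambda>,
      restrict (\<lambda>\<mu>. block_sizes N (eigenspace S \<mu>)) \<Lambda>))"

end

theory Submission
  imports
    Defs
    "Jordan_Normal_Form.Jordan_Normal_Form_Uniqueness"
    "Jordan_Normal_Form.DL_Rank"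
begin

text \<open>
  Let \<open>G\<close> be the Gram matrix of the form \<open>B\<close>. The triple of \<open>C\<close> is a repackaging of the list of
  Jordan blocks of \<open>C\<close>: if \<open>C = P J P\<inverse>\<close> with a Jordan matrix \<open>J\<close>, then the diagonal of \<open>J\<close> and
  its superdiagonal, transported by \<open>P\<close>, are the commuting semisimple and nilpotent parts of \<open>C\<close>
  (uniqueness of that decomposition is \<open>commuting_semisimple_nilpotent_unique\<close>), and the columns of
  \<open>P\<close> that belong to the blocks for \<open>\<mu>\<close> are a basis of the \<open>\<mu>\<close>-eigenspace of the semisimple part in
  which the nilpotent part is a direct sum of nilpotent blocks. This is
  \<open>jordan_triple_of_jordan_nf\<close>. So two matrices have the same triple exactly when they are similar,
  and the theorem has three parts.

  The triple of an invertible \<open>C\<close> in the Lie algebra is admissible: skewness says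
  \<open>C = G (- C\<^sup>T) G\<inverse>\<close>, and \<open>- C\<^sup>T\<close> has the Jordan blocks of \<open>C\<close> with negated eigenvalues, so
  blocks for \<open>\<mu>\<close> and \<open>- \<mu>\<close> match (\<open>orth_lie_algebra_jordan_nf_symmetric\<close>).

  Every admissible triple occurs: as \<open>0\<close> is not in \<open>\<Lambda>\<close>, exactly one of \<open>\<mu>\<close>, \<open>- \<mu>\<close> lies in a
  fixed half \<open>H\<close> of the punctured plane. Let \<open>J\<close> be the \<open>p \<times> p\<close> Jordan matrix of the prescribed
  blocks with eigenvalue in \<open>H\<close>. Then \<open>diag(J, - J\<^sup>T)\<close> is skew and has the prescribed blocks
  (\<open>skew_normal_form\<close>).

  Similarity implies orthogonal conjugacy (\<open>orth_conjugate_hyperbolic\<close>): let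
  \<open>C = P D P\<inverse>\<close> with \<open>D = diag(J, - J\<^sup>T)\<close>. The transported form \<open>P\<^sup>T G P\<close> is again one for which \<open>D\<close>
  is skew. Its diagonal blocks solve Sylvester equations \<open>A X + X A\<^sup>T = 0\<close> with \<open>A\<close> triangular and no
  two diagonal entries of \<open>A\<close> adding up to \<open>0\<close>, hence vanish; that is, the sum of the
  generalised eigenspaces for \<open>H\<close> and that for \<open>- H\<close> are totally isotropic. The off-diagonal block is an
  invertible matrix \<open>Y\<close> that commutes with \<open>J\<^sup>T\<close>. So \<open>R = diag(1, Y\<inverse>)\<close> commutes with \<open>D\<close> and
  brings the form back to \<open>G\<close>, and \<open>P R\<close> is an orthogonal matrix that conjugates \<open>D\<close> to \<open>C\<close>.
\<close>

section \<open>Rearranging and comparing Jordan blocks\<close>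

lemma jordan_matrix_append:
  "jordan_matrix (xs @ ys) = four_block_mat (jordan_matrix xs)
     (0\<^sub>m (sum_list (map fst xs)) (sum_list (map fst ys)))
     (0\<^sub>m (sum_list (map fst ys)) (sum_list (map fst xs))) (jordan_matrix ys)"
  by (simp add: jordan_matrix_def diag_block_mat_append Let_def)
     (simp add: jordan_matrix_def[symmetric])

text \<open>The conjugating matrix is the block permutation that exchanges the two groups of coordinates.\<close>

lemma similar_swap_diagonal_blocks:
  fixes A B :: "'a :: comm_ring_1 mat"
  assumes A: "A \<in> carrier_mat n n" and B: "B \<in> carrier_mat m m"
  shows "similar_mat (four_block_mat A (0\<^sub>m n m) (0\<^sub>m m n) B)
                     (four_block_mat B (0\<^sub>m m n) (0\<^sub>m n m) A)"
proof -
  let ?P = "four_block_mat (0\<^sub>m n m) (1\<^sub>m n) (1\<^sub>m m) (0\<^sub>m m n) :: 'a mat"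
  let ?Q = "four_block_mat (0\<^sub>m m n) (1\<^sub>m m) (1\<^sub>m n) (0\<^sub>m n m) :: 'a mat"
  let ?FA = "four_block_mat A (0\<^sub>m n m) (0\<^sub>m m n) B"
  let ?FB = "four_block_mat B (0\<^sub>m m n) (0\<^sub>m n m) A"
  have PQ: "?P * ?Q = 1\<^sub>m (n + m)"
    by (subst mult_four_block_mat[where ?n1.0=m and ?n2.0=n]) auto
  have QP: "?Q * ?P = 1\<^sub>m (m + n)"
    by (subst mult_four_block_mat[where ?n1.0=n and ?n2.0=m]) auto
  have PB: "?P * ?FB = four_block_mat (0\<^sub>m n m) A B (0\<^sub>m m n)"
    by (subst mult_four_block_mat[where ?n1.0=m and ?n2.0=n]) (use A B in auto)
  have "?FA = ?P * ?FB * ?Q"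
    unfolding PB by (subst mult_four_block_mat[where ?n1.0=m and ?n2.0=n]) (use A B in auto)
  with PQ QP show ?thesis
    by (intro similar_matI[of _ _ ?P ?Q "n + m"])
       (use A B in \<open>auto intro!: carrier_matI simp: add.commute\<close>)
qed

lemma similar_jordan_matrix_cong_mset:
  fixes xs ys :: "(nat \<times> 'a :: comm_ring_1) list"
  assumes "mset xs = mset ys"
  shows "similar_mat (jordan_matrix xs) (jordan_matrix ys)"
  using assms
proof (induction xs arbitrary: ys)
  case Nil
  then show ?case by (auto intro: similar_mat_refl[OF jordan_matrix_carrier])
next
  case (Cons x xs)
  then have "x \<in> set ys" by (metis list.set_intros(1) mset_eq_setD)
  then obtain ys1 ys2 where ys: "ys = ys1 @ x # ys2" by (meson split_list)
  obtain k a where x: "x = (k, a)" by force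
  have "mset xs = mset (ys2 @ ys1)" using Cons.prems ys by simp
  from Cons.IH[OF this] have IH: "similar_mat (jordan_matrix xs) (jordan_matrix (ys2 @ ys1))" .
  have dims: "sum_list (map fst xs) = sum_list (map fst (ys2 @ ys1))"
    by (metis \<open>mset xs = mset (ys2 @ ys1)\<close> mset_map sum_mset_sum_list)
  have 1: "similar_mat (jordan_matrix (x # xs)) (jordan_matrix ((x # ys2) @ ys1))"
    unfolding x append_Cons jordan_matrix_Cons dims
    by (rule similar_mat_four_block_0_0[OF similar_mat_refl[of _ k] IH])
       (use dims jordan_matrix_carrier[of xs] in auto)
  have 2: "similar_mat (jordan_matrix ((x # ys2) @ ys1)) (jordan_matrix (ys1 @ (x # ys2)))"
    unfolding jordan_matrix_append by (rule similar_swap_diagonal_blocks) auto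
  from similar_mat_trans[OF 1 2] show ?case unfolding ys .
qed

lemma jordan_nf_cong_mset:
  fixes xs ys :: "(nat \<times> 'a :: comm_ring_1) list"
  assumes "jordan_nf A xs" "mset xs = mset ys"
  shows "jordan_nf A ys"
  using assms similar_mat_trans[OF _ similar_jordan_matrix_cong_mset[OF assms(2)], of A]
  by (auto simp: jordan_nf_def dest: mset_eq_setD)

text \<open>
  The kernels of the powers of \<open>A - a\<close> determine how often each block of positive size occurs, hence the
  block list up to order, with multiplicities; blocks of size \<open>0\<close> are excluded from Jordan normal forms.
\<close>

lemma jordan_nf_unique_mset:
  fixes xs ys :: "(nat \<times> 'a :: field) list"
  assumes xs: "jordan_nf A xs" and ys: "jordan_nf A ys"
  shows "mset xs = mset ys"
proof (rule multiset_eqI)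
  fix x :: "nat \<times> 'a"
  obtain k a where x: "x = (k, a)" by force
  show "count (mset xs) x = count (mset ys) x"
  proof (cases "k = 0")
    case True
    then have "x \<notin> set xs" "x \<notin> set ys"
      using xs ys x unfolding jordan_nf_def by force+
    then show ?thesis by (metis count_mset_0_iff)
  next
    case False
    show ?thesis
      using compute_nr_of_jordan_blocks[OF xs False, of a]
        compute_nr_of_jordan_blocks[OF ys False, of a]
      by (simp add: x count_mset count_list_eq_length_filter)
  qed
qed

lemma jordan_nf_similar:
  assumes "similar_mat A B" "jordan_nf B xs"
  shows "jordan_nf A xs"
  using assms similar_mat_trans unfolding jordan_nf_def by blast

text \<open>
  Reversing the order of the basis turns the transposed block back into an upper triangular one, and
  alternating signs turn the \<open>-1\<close> above the diagonal into \<open>1\<close>. The matrix \<open>Q\<close> does both at once.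
\<close>

lemma similar_uminus_transpose_jordan_block:
  fixes a :: "'a :: field"
  shows "similar_mat (- (jordan_block n a)\<^sup>T) (jordan_block n (- a))"
proof -
  define Q where "Q = mat n n (\<lambda>(i,j). if i + j = n - 1 then (- 1) ^ i else (0::'a))"
  have Q: "Q \<in> carrier_mat n n" by (simp add: Q_def)
  have sel: "(\<Sum>k = 0..<n. f k * (if k = m then c else 0)) = f m * c" if "m < n" for f :: "nat \<Rightarrow> 'a" and m c
  proof -
    have "(\<Sum>k = 0..<n. f k * (if k = m then c else 0)) = (\<Sum>k = 0..<n. if k = m then f m * c else 0)"
      by (intro sum.cong) auto
    then show ?thesis using that by simp
  qed
  have Q_col: "Q $$ (k, j) = (if k = n - 1 - j then (- 1) ^ (n - 1 - j) else 0)" if "k < n" "j < n" for k j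
    using that by (auto simp: Q_def)
  have Q_row: "Q $$ (i, k) = (if k = n - 1 - i then (- 1) ^ i else 0)" if "k < n" "i < n" for k i
    using that by (auto simp: Q_def)
  have QQ: "Q * Q\<^sup>T = 1\<^sub>m n"
  proof (rule eq_matI)
    fix i j assume ij: "i < dim_row (1\<^sub>m n :: 'a mat)" "j < dim_col (1\<^sub>m n :: 'a mat)"
    have "(Q * Q\<^sup>T) $$ (i, j) = (\<Sum>k = 0..<n. Q $$ (i, k) * Q $$ (j, k))"
      using ij Q by (auto simp: scalar_prod_def intro!: sum.cong)
    also have "\<dots> = (\<Sum>k = 0..<n. Q $$ (i, k) * (if k = n - 1 - j then (- 1) ^ j else 0))"
      using ij by (intro sum.cong) (auto simp: Q_row)
    also have "\<dots> = Q $$ (i, n - 1 - j) * (- 1) ^ j" using ij by (subst sel) auto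
    also have "\<dots> = (if i = j then 1 else 0)" using ij by (auto simp: Q_row power_add[symmetric])
    finally show "(Q * Q\<^sup>T) $$ (i, j) = 1\<^sub>m n $$ (i, j)" using ij by simp
  qed (use Q in auto)
  have QQ': "Q\<^sup>T * Q = 1\<^sub>m n"
    by (rule mat_mult_left_right_inverse[OF _ _ QQ]) (use Q in auto)
  have comm: "- (jordan_block n a)\<^sup>T * Q = Q * jordan_block n (- a)"
  proof (rule eq_matI)
    fix i j assume "i < dim_row (Q * jordan_block n (- a))" "j < dim_col (Q * jordan_block n (- a))"
    with Q have ij: "i < n" "j < n" by auto
    have "(- (jordan_block n a)\<^sup>T * Q) $$ (i, j) = (\<Sum>k = 0..<n. - jordan_block n a $$ (k, i) * Q $$ (k, j))"
      using ij Q by (auto simp: scalar_prod_def simp: sum_negf[symmetric] intro!: sum.cong)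
    also have "\<dots> = (\<Sum>k = 0..<n. - jordan_block n a $$ (k, i) * (if k = n - 1 - j then (- 1) ^ (n - 1 - j) else 0))"
      using ij by (intro sum.cong) (auto simp: Q_col)
    also have "\<dots> = - jordan_block n a $$ (n - 1 - j, i) * (- 1) ^ (n - 1 - j)" using ij by (subst sel) auto
    also have "\<dots> = (- 1) ^ i * jordan_block n (- a) $$ (n - 1 - i, j)"
    proof -
      consider "i = n - 1 - j" | "i = Suc (n - 1 - j)" | "i \<noteq> n - 1 - j" "i \<noteq> Suc (n - 1 - j)" by blast
      then show ?thesis
      proof cases
        case 2
        then have "Suc (n - 1 - i) = j" using ij by simp
        with 2 show ?thesis using ij by (auto simp: power_Suc)
      qed (use ij in auto)
    qed
    also have "\<dots> = (\<Sum>k = 0..<n. jordan_block n (- a) $$ (k, j) * (if k = n - 1 - i then (- 1) ^ i else 0))"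
      using ij by (subst sel) (auto simp: mult.commute)
    also have "\<dots> = (\<Sum>k = 0..<n. Q $$ (i, k) * jordan_block n (- a) $$ (k, j))"
      using ij by (intro sum.cong) (auto simp: Q_row)
    also have "\<dots> = (Q * jordan_block n (- a)) $$ (i, j)"
      using ij Q by (auto simp: scalar_prod_def intro!: sum.cong)
    finally show "(- (jordan_block n a)\<^sup>T * Q) $$ (i, j) = (Q * jordan_block n (- a)) $$ (i, j)" .
  qed (use Q in auto)
  have "Q * jordan_block n (- a) * Q\<^sup>T = - (jordan_block n a)\<^sup>T * (Q * Q\<^sup>T)"
    unfolding comm[symmetric] by (rule assoc_mult_mat) (use Q in auto)
  also have "\<dots> = - (jordan_block n a)\<^sup>T" unfolding QQ by (rule right_mult_one_mat) auto
  finally show ?thesis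
    by (intro similar_matI[of _ _ Q "Q\<^sup>T" n]) (use Q QQ QQ' in auto)
qed

definition negate_blocks :: "(nat \<times> 'a :: uminus) list \<Rightarrow> (nat \<times> 'a) list" where
  "negate_blocks xs = map (\<lambda>(k, a). (k, - a)) xs"

lemma map_fst_negate_blocks [simp]: "map fst (negate_blocks xs) = map fst xs"
  by (auto simp: negate_blocks_def)

lemma similar_uminus_transpose_jordan_matrix:
  fixes xs :: "(nat \<times> 'a :: field) list"
  shows "similar_mat (- (jordan_matrix xs)\<^sup>T) (jordan_matrix (negate_blocks xs))"
proof (induction xs)
  case Nil
  have "- (jordan_matrix [] :: 'a mat)\<^sup>T = jordan_matrix []"
    by (rule eq_matI) (auto simp: jordan_matrix_def)
  then show ?case by (auto simp: negate_blocks_def intro: similar_mat_refl[OF jordan_matrix_carrier])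
next
  case (Cons x xs)
  obtain k a where x: "x = (k, a)" by force
  let ?n = "sum_list (map fst xs)"
  have "- (jordan_matrix (x # xs))\<^sup>T = four_block_mat (- (jordan_block k a)\<^sup>T) (0\<^sub>m k ?n)
      (0\<^sub>m ?n k) (- (jordan_matrix xs)\<^sup>T)"
    unfolding x jordan_matrix_Cons
    by (rule eq_matI) (auto)
  moreover have "jordan_matrix (negate_blocks (x # xs)) = four_block_mat (jordan_block k (- a)) (0\<^sub>m k ?n)
      (0\<^sub>m ?n k) (jordan_matrix (negate_blocks xs))"
    using jordan_matrix_Cons[of k "-a" "negate_blocks xs"]
    unfolding map_fst_negate_blocks by (simp add: x negate_blocks_def)
  ultimately show ?case
    by (simp add: similar_mat_four_block_0_0[OF similar_uminus_transpose_jordan_block Cons.IH])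
qed

section \<open>Semisimple and nilpotent parts\<close>

definition diagonal_part :: "(nat \<times> 'a :: semiring_1) list \<Rightarrow> 'a mat" where
  "diagonal_part xs = diag_block_mat (map (\<lambda>(k, a). a \<cdot>\<^sub>m 1\<^sub>m k) xs)"

definition nilpotent_part :: "(nat \<times> 'a :: {zero,one}) list \<Rightarrow> 'a mat" where
  "nilpotent_part xs = jordan_matrix (map (\<lambda>(k, a). (k, 0)) xs)"

lemma map_fst_zero_blocks [simp]: "map fst (map (\<lambda>(k, a). (k, 0)) xs) = map fst xs"
  by auto

lemma diagonal_part_dim [simp]:
  "dim_row (diagonal_part xs) = sum_list (map fst xs)"
  "dim_col (diagonal_part xs) = sum_list (map fst xs)"
  by (auto simp: diagonal_part_def dim_diag_block_mat o_def split_def)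

lemma diagonal_part_carrier [simp]:
  "diagonal_part xs \<in> carrier_mat (sum_list (map fst xs)) (sum_list (map fst xs))"
  by (rule carrier_matI) auto

lemma nilpotent_part_dim [simp]:
  "dim_row (nilpotent_part xs) = sum_list (map fst xs)"
  "dim_col (nilpotent_part xs) = sum_list (map fst xs)"
  unfolding nilpotent_part_def jordan_matrix_dim map_fst_zero_blocks by auto

lemma nilpotent_part_carrier [simp]:
  "nilpotent_part xs \<in> carrier_mat (sum_list (map fst xs)) (sum_list (map fst xs))"
  by (rule carrier_matI) auto

lemma diagonal_part_append:
  "diagonal_part (xs @ ys) = four_block_mat (diagonal_part xs)
     (0\<^sub>m (sum_list (map fst xs)) (sum_list (map fst ys)))
     (0\<^sub>m (sum_list (map fst ys)) (sum_list (map fst xs))) (diagonal_part ys)"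
  unfolding diagonal_part_def map_append diag_block_mat_append Let_def
  unfolding diagonal_part_def[symmetric] diagonal_part_dim ..

lemma diagonal_part_Cons:
  "diagonal_part ((k, a) # xs) = four_block_mat (a \<cdot>\<^sub>m 1\<^sub>m k)
     (0\<^sub>m k (sum_list (map fst xs))) (0\<^sub>m (sum_list (map fst xs)) k) (diagonal_part xs)"
  by (simp add: diagonal_part_def Let_def) (simp add: diagonal_part_def[symmetric])

lemma nilpotent_part_append:
  "nilpotent_part (xs @ ys) = four_block_mat (nilpotent_part xs)
     (0\<^sub>m (sum_list (map fst xs)) (sum_list (map fst ys)))
     (0\<^sub>m (sum_list (map fst ys)) (sum_list (map fst xs))) (nilpotent_part ys)"
  unfolding nilpotent_part_def map_append jordan_matrix_append map_fst_zero_blocks ..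

lemma nilpotent_part_Cons:
  "nilpotent_part ((k, a) # xs) = four_block_mat (jordan_block k 0)
     (0\<^sub>m k (sum_list (map fst xs))) (0\<^sub>m (sum_list (map fst xs)) k) (nilpotent_part xs)"
  unfolding nilpotent_part_def list.map prod.case jordan_matrix_Cons map_fst_zero_blocks ..

lemma jordan_matrix_eq_parts:
  fixes xs :: "(nat \<times> 'a :: semiring_1) list"
  shows "jordan_matrix xs = diagonal_part xs + nilpotent_part xs"
proof (induction xs)
  case Nil
  show ?case by (rule eq_matI) auto
next
  case (Cons x xs)
  obtain k a where x: "x = (k, a)" by force
  have "jordan_block k a = a \<cdot>\<^sub>m 1\<^sub>m k + jordan_block k 0"
    by (rule eq_matI) auto
  then show ?case
    unfolding x jordan_matrix_Cons diagonal_part_Cons nilpotent_part_Cons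
    by (subst add_four_block_mat) (auto simp: Cons.IH[symmetric])
qed

text \<open>On each block the diagonal part is a scalar matrix.\<close>

lemma diagonal_part_commute:
  fixes xs :: "(nat \<times> 'a :: comm_ring_1) list"
  shows "diagonal_part xs * nilpotent_part xs = nilpotent_part xs * diagonal_part xs"
proof (induction xs)
  case Nil
  show ?case by (rule eq_matI) auto
next
  case (Cons x xs)
  obtain k a where x: "x = (k, a)" by force
  let ?n = "sum_list (map fst xs)"
  have "(a \<cdot>\<^sub>m 1\<^sub>m k) * jordan_block k 0 = jordan_block k 0 * (a \<cdot>\<^sub>m 1\<^sub>m k)"
    using mult_smult_assoc_mat[OF one_carrier_mat jordan_block_carrier, of a k 0]
      mult_smult_distrib[OF jordan_block_carrier one_carrier_mat, of k 0 a] by simp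
  then show ?case
    unfolding x diagonal_part_Cons nilpotent_part_Cons
    by (subst (1 2) mult_four_block_mat[where ?n1.0=k and ?n2.0="?n"]) (auto simp: Cons.IH)
qed

lemma diagonal_part_index:
  fixes xs :: "(nat \<times> 'a :: semiring_1) list"
  assumes "i < sum_list (map fst xs)" "j < sum_list (map fst xs)"
  shows "diagonal_part xs $$ (i, j) = (if i = j then jordan_matrix xs $$ (i, i) else 0)"
  using assms
proof (induction xs arbitrary: i j)
  case (Cons x xs)
  obtain k a where x: "x = (k, a)" by force
  show ?case using Cons.prems Cons.IH[of "i - k" "j - k"]
    by (auto simp: x diagonal_part_Cons jordan_matrix_Cons)
qed auto

lemma diagonal_part_entry:
  fixes xs :: "(nat \<times> 'a :: semiring_1) list"
  assumes "i < sum_list (map fst xs)"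
  shows "diagonal_part xs $$ (i, i) \<in> snd ` set xs"
  using assms
proof (induction xs arbitrary: i)
  case (Cons x xs)
  obtain k a where x: "x = (k, a)" by force
  show ?case using Cons.prems Cons.IH[of "i - k"]
    by (auto simp: x diagonal_part_Cons)
qed auto

lemma diagonal_part_diagonal: "diagonal_mat (diagonal_part xs)"
  for xs :: "(nat \<times> 'a :: semiring_1) list"
  by (auto simp: diagonal_mat_def diagonal_part_index)

lemma nilpotent_part_pow_eq_0:
  fixes xs :: "(nat \<times> 'a :: comm_ring_1) list"
  assumes "\<forall>x\<in>set xs. fst x \<le> r"
  shows "nilpotent_part xs ^\<^sub>m r = 0\<^sub>m (sum_list (map fst xs)) (sum_list (map fst xs))"
  using assms
proof (induction xs)
  case Nil
  show ?case by (rule eq_matI) auto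
next
  case (Cons x xs)
  obtain k a where x: "x = (k, a)" by force
  have "k \<le> r" using Cons.prems x by simp
  then have "jordan_block k (0::'a) ^\<^sub>m r = 0\<^sub>m k k"
    by (auto simp: jordan_block_pow power_0_left intro!: eq_matI)
  then show ?case
    unfolding x nilpotent_part_Cons
    by (subst pow_four_block_mat[where m="sum_list (map fst xs)"])
       (use Cons in auto)
qed

lemma char_poly_diagonal_part:
  fixes xs :: "(nat \<times> 'a :: comm_ring_1) list"
  shows "char_poly (diagonal_part xs) = char_poly (jordan_matrix xs)"
proof -
  have "diag_mat (diagonal_part xs) = diag_mat (jordan_matrix xs)"
    by (auto simp: diag_mat_def diagonal_part_index)
  moreover have "upper_triangular (diagonal_part xs)" "upper_triangular (jordan_matrix xs)"
    by (auto simp: upper_triangular_def diagonal_part_index jordan_matrix_upper_triangular)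
  ultimately show ?thesis
    by (metis char_poly_upper_triangular diagonal_part_carrier jordan_matrix_carrier)
qed

lemma commute_pow_mat:
  fixes A B :: "'a :: semiring_1 mat"
  assumes "A \<in> carrier_mat n n" "B \<in> carrier_mat n n" "A * B = B * A"
  shows "A * B ^\<^sub>m k = B ^\<^sub>m k * A"
proof (induction k)
  case (Suc k)
  have "A * (B ^\<^sub>m k * B) = (A * B ^\<^sub>m k) * B"
    by (rule assoc_mult_mat[symmetric]) (use assms in auto)
  also have "\<dots> = (B ^\<^sub>m k * A) * B" using Suc by simp
  also have "\<dots> = B ^\<^sub>m k * (A * B)" by (rule assoc_mult_mat) (use assms in auto)
  also have "\<dots> = (B ^\<^sub>m k * B) * A"
    unfolding assms(3) by (rule assoc_mult_mat[symmetric]) (use assms in auto)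
  finally show ?case by simp
qed (use assms in auto)

lemma pow_mat_eq_0_mono:
  fixes A :: "'a :: semiring_1 mat"
  assumes "A \<in> carrier_mat n n" "A ^\<^sub>m k = 0\<^sub>m n n" "k \<le> l"
  shows "A ^\<^sub>m l = 0\<^sub>m n n"
  using assms(3) by (induction l rule: dec_induct) (use assms in auto)

lemma diagonal_mult_index:
  fixes D :: "'a :: semiring_0 mat"
  assumes D: "D \<in> carrier_mat n n" "diagonal_mat D" and X: "X \<in> carrier_mat n m"
    and ij: "i < n" "j < m"
  shows "(D * X) $$ (i, j) = D $$ (i, i) * X $$ (i, j)"
proof -
  have "(D * X) $$ (i, j) = (\<Sum>k = 0..<n. D $$ (i, k) * X $$ (k, j))"
    using assms by (auto simp: scalar_prod_def intro!: sum.cong)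
  also have "\<dots> = (\<Sum>k = 0..<n. if k = i then D $$ (i, i) * X $$ (i, j) else 0)"
    using assms by (intro sum.cong) (auto simp: diagonal_mat_def)
  finally show ?thesis using ij by simp
qed

lemma mult_diagonal_index:
  fixes D :: "'a :: semiring_0 mat"
  assumes D: "D \<in> carrier_mat n n" "diagonal_mat D" and X: "X \<in> carrier_mat m n"
    and ij: "i < m" "j < n"
  shows "(X * D) $$ (i, j) = X $$ (i, j) * D $$ (j, j)"
proof -
  have "(X * D) $$ (i, j) = (\<Sum>k = 0..<n. X $$ (i, k) * D $$ (k, j))"
    using assms by (auto simp: scalar_prod_def intro!: sum.cong)
  also have "\<dots> = (\<Sum>k = 0..<n. if k = j then X $$ (i, j) * D $$ (j, j) else 0)"
    using assms by (intro sum.cong) (auto simp: diagonal_mat_def)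
  finally show ?thesis using ij by simp
qed

text \<open>
  Diagonalise \<open>S = P D P\<inverse>\<close> and \<open>S' = P' D' P'\<inverse>\<close>. It is enough that \<open>P'\<inverse> P\<close> intertwines \<open>D\<close> and \<open>D'\<close>,
  i.e. that its entry \<open>(i, j)\<close> vanishes when the eigenvalues \<open>D' i\<close> and \<open>D j\<close> differ. The matrices
  \<open>T b a = P'\<inverse> N'\<^sup>b N\<^sup>a P\<close> satisfy \<open>D' T b a - T b a D = T b (a + 1) - T (b + 1) a\<close>, because
  \<open>S' - S = N - N'\<close>, and they vanish for large \<open>a\<close> or \<open>b\<close> by nilpotency. Downward induction on \<open>a + b\<close>
  gives the vanishing of the entry \<open>(i, j)\<close> of all \<open>T b a\<close>, in particular of \<open>T 0 0 = P'\<inverse> P\<close>. This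
  avoids any use of generalised eigenspaces or of polynomials in \<open>S + N\<close>.
\<close>

lemma commuting_semisimple_nilpotent_unique:
  assumes S: "S \<in> carrier_mat n n" and N: "N \<in> carrier_mat n n"
    and S': "S' \<in> carrier_mat n n" and N': "N' \<in> carrier_mat n n"
    and sum: "S + N = S' + N'"
    and comm: "S * N = N * S" and comm': "S' * N' = N' * S'"
    and ss: "semisimple_mat S" and ss': "semisimple_mat S'"
    and nil: "nilpotent_mat N" and nil': "nilpotent_mat N'"
  shows "S = S'"
proof -
  obtain D P Q where D: "diagonal_mat D" and w: "similar_mat_wit S D P Q"
    using ss unfolding semisimple_mat_def similar_mat_def by blast
  obtain D' P' Q' where D': "diagonal_mat D'" and w': "similar_mat_wit S' D' P' Q'"
    using ss' unfolding semisimple_mat_def similar_mat_def by blast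
  note w = similar_mat_witD2[OF S w] and w' = similar_mat_witD2[OF S' w']
  note [simp] = S N S' N' w(4-7) w'(4-7)
  note assoc = assoc_mult_mat[of _ n n _ n _ n]
  note closed [simp] = mult_carrier_mat[of _ n n _ n]
  obtain k where k: "N ^\<^sub>m k = 0\<^sub>m n n" using nil N unfolding nilpotent_mat_def by auto
  obtain l where l: "N' ^\<^sub>m l = 0\<^sub>m n n" using nil' N' unfolding nilpotent_mat_def by auto
  define T where "T b a = Q' * (N' ^\<^sub>m b * (N ^\<^sub>m a * P))" for b a
  have T_carrier: "T b a \<in> carrier_mat n n" for b a by (simp add: T_def)
  have DQ: "D' * Q' = Q' * S'"
  proof -
    have "Q' * S' = (Q' * P') * (D' * Q')" unfolding w'(3) by (simp add: assoc)
    then show ?thesis by (simp add: w'(2) left_mult_one_mat[of _ n n])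
  qed
  have PD: "P * D = S * P"
  proof -
    have "S * P = (P * D) * (Q * P)" unfolding w(3) by (simp add: assoc)
    then show ?thesis by (simp add: w(2) right_mult_one_mat[of _ n n])
  qed
  have left: "D' * T b a + T (Suc b) a = Q' * (N' ^\<^sub>m b * ((S' + N') * (N ^\<^sub>m a * P)))" for b a
  proof -
    have "D' * T b a = (D' * Q') * (N' ^\<^sub>m b * (N ^\<^sub>m a * P))"
      unfolding T_def by (rule assoc[symmetric]) auto
    also have "\<dots> = Q' * ((S' * N' ^\<^sub>m b) * (N ^\<^sub>m a * P))" unfolding DQ by (simp add: assoc)
    also have "\<dots> = Q' * (N' ^\<^sub>m b * (S' * (N ^\<^sub>m a * P)))"
      unfolding commute_pow_mat[OF S' N' comm'] by (simp add: assoc)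
    finally have 1: "D' * T b a = Q' * (N' ^\<^sub>m b * (S' * (N ^\<^sub>m a * P)))" .
    have 2: "T (Suc b) a = Q' * (N' ^\<^sub>m b * (N' * (N ^\<^sub>m a * P)))"
      unfolding T_def by (simp add: assoc)
    show ?thesis unfolding 1 2
      by (simp add: add_mult_distrib_mat[of _ n n _ _ n] mult_add_distrib_mat[of _ n n _ n])
  qed
  have right: "T b a * D + T b (Suc a) = Q' * (N' ^\<^sub>m b * ((S + N) * (N ^\<^sub>m a * P)))" for b a
  proof -
    have "T b a * D = Q' * (N' ^\<^sub>m b * (N ^\<^sub>m a * (P * D)))"
      unfolding T_def by (simp add: assoc)
    also have "\<dots> = Q' * (N' ^\<^sub>m b * ((N ^\<^sub>m a * S) * P))" unfolding PD by (simp add: assoc)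
    also have "\<dots> = Q' * (N' ^\<^sub>m b * (S * (N ^\<^sub>m a * P)))"
      unfolding commute_pow_mat[OF S N comm, symmetric] by (simp add: assoc)
    finally have 1: "T b a * D = Q' * (N' ^\<^sub>m b * (S * (N ^\<^sub>m a * P)))" .
    have "N ^\<^sub>m a * N = N * N ^\<^sub>m a" using commute_pow_mat[OF N N, of a] by simp
    then have "N ^\<^sub>m Suc a * P = N * (N ^\<^sub>m a * P)" by (simp add: assoc)
    then have 2: "T b (Suc a) = Q' * (N' ^\<^sub>m b * (N * (N ^\<^sub>m a * P)))"
      unfolding T_def by simp
    show ?thesis unfolding 1 2
      by (simp add: add_mult_distrib_mat[of _ n n _ _ n] mult_add_distrib_mat[of _ n n _ n])
  qed
  have rec: "D' * T b a + T (Suc b) a = T b a * D + T b (Suc a)" for b a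
    unfolding left right sum ..
  note D_mult = diagonal_mult_index[OF w'(5) D'] and mult_D = mult_diagonal_index[OF w(5) D]
  note dims = carrier_matD[OF w(5)] carrier_matD[OF w'(5)] carrier_matD[OF w(6)] carrier_matD[OF w'(7)]
  have zero: "T b a $$ (i, j) = 0" if ij: "i < n" "j < n" "D' $$ (i, i) \<noteq> D $$ (j, j)" for i j b a
  proof (induction "(l - b) + (k - a)" arbitrary: a b rule: less_induct)
    case less
    show ?case
    proof (cases "b < l \<and> a < k")
      case True
      then have "T (Suc b) a $$ (i, j) = 0" "T b (Suc a) $$ (i, j) = 0" by (auto intro!: less)
      moreover have "(D' * T b a + T (Suc b) a) $$ (i, j) = (T b a * D + T b (Suc a)) $$ (i, j)"
        unfolding rec ..
      ultimately have "(D' $$ (i, i) - D $$ (j, j)) * T b a $$ (i, j) = 0"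
        using ij T_carrier[of b a] T_carrier[of "Suc b" a] T_carrier[of b "Suc a"]
          D_mult[OF T_carrier[of b a] ij(1,2)] mult_D[OF T_carrier[of b a] ij(1,2)] dims
        by (simp add: algebra_simps)
      then show ?thesis using ij by simp
    next
      case False
      then have "N' ^\<^sub>m b = 0\<^sub>m n n \<or> N ^\<^sub>m a = 0\<^sub>m n n"
        using pow_mat_eq_0_mono[OF N' l, of b] pow_mat_eq_0_mono[OF N k, of a] by linarith
      then have "T b a = 0\<^sub>m n n"
        unfolding T_def by (auto simp: left_mult_zero_mat[of _ n n] right_mult_zero_mat[of _ n n])
      then show ?thesis using ij by simp
    qed
  qed
  have "D' * (Q' * P) = (Q' * P) * D"
  proof (rule eq_matI)
    fix i j assume "i < dim_row ((Q' * P) * D)" "j < dim_col ((Q' * P) * D)"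
    then have ij: "i < n" "j < n" using dims by auto
    have "T 0 0 = Q' * P"
      unfolding T_def using carrier_matD(1)[OF N] carrier_matD(1)[OF N']
      by (simp add: left_mult_one_mat[of _ n n])
    then have "D' $$ (i, i) = D $$ (j, j) \<or> (Q' * P) $$ (i, j) = 0" using zero[OF ij, of 0 0] by auto
    then show "(D' * (Q' * P)) $$ (i, j) = ((Q' * P) * D) $$ (i, j)"
      using D_mult[where X = "Q' * P" and m = n, OF _ ij] mult_D[where X = "Q' * P" and m = n, OF _ ij] by (auto simp: mult.commute)
  qed (use dims in auto)
  then have eq: "Q' * (S' * P) = Q' * (S * P)"
  proof -
    assume "D' * (Q' * P) = (Q' * P) * D"
    then have "(D' * Q') * P = Q' * (P * D)" by (simp add: assoc)
    then show ?thesis unfolding DQ PD by (simp add: assoc)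
  qed
  have "X = P' * (Q' * (X * P)) * Q" if "X \<in> carrier_mat n n" for X
  proof -
    have "P' * (Q' * (X * P)) * Q = (P' * Q') * (X * (P * Q))" using that by (simp add: assoc)
    then show ?thesis using that by (simp add: w(1) w'(1))
  qed
  then show ?thesis using eq S S' by metis
qed

lemma jordan_decomposition_eqI:
  assumes S: "S \<in> carrier_mat n n" and N: "N \<in> carrier_mat n n" and C: "C = S + N"
    and comm: "S * N = N * S" and ss: "semisimple_mat S" and nil: "nilpotent_mat N"
  shows "jordan_decomposition C = (S, N)"
proof -
  have n: "dim_row C = n" using C S N by simp
  show ?thesis
    unfolding jordan_decomposition_def Let_def n
  proof (rule the_equality, goal_cases)
    case 1
    then show ?case using assms by simp
  next
    case (2 SN)
    obtain S' N' where SN: "SN = (S', N')" by force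
    note 2 = 2[unfolded SN prod.case]
    have "S' = S"
      by (rule commuting_semisimple_nilpotent_unique[of S' n N' S N]) (use 2 assms in auto)
    moreover have "N' = N"
    proof -
      have "N' = (S + N') - S" using 2 S by (intro eq_matI) auto
      also have "S + N' = S + N" using 2 C \<open>S' = S\<close> by simp
      also have "S + N - S = N" using N S by (intro eq_matI) auto
      finally show ?thesis .
    qed
    ultimately show ?case using SN by simp
  qed
qed

lemma jordan_decomposition_of_wit:
  assumes C: "C \<in> carrier_mat n n" and w: "similar_mat_wit C (jordan_matrix xs) P Q"
  shows "jordan_decomposition C = (P * diagonal_part xs * Q, P * nilpotent_part xs * Q)"
proof -
  note w = similar_mat_witD2[OF C w]
  have n: "sum_list (map fst xs) = n" using w(5) by auto
  have D: "diagonal_part xs \<in> carrier_mat n n" and N: "nilpotent_part xs \<in> carrier_mat n n"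
    using n diagonal_part_carrier[of xs] nilpotent_part_carrier[of xs] by auto
  note [simp] = D N w(4-7)
  note assoc = assoc_mult_mat[of _ n n _ n _ n]
  note closed [simp] = mult_carrier_mat[of _ n n _ n]
  have cancel: "(P * X * Q) * (P * Y * Q) = P * (X * Y) * Q"
    if "X \<in> carrier_mat n n" "Y \<in> carrier_mat n n" for X Y
  proof -
    have "(P * X * Q) * (P * Y * Q) = P * (X * ((Q * P) * (Y * Q)))"
      using that by (simp add: assoc)
    also have "\<dots> = P * (X * Y) * Q" using that by (simp add: assoc w(2))
    finally show ?thesis .
  qed
  show ?thesis
  proof (rule jordan_decomposition_eqI[where n = n])
    show "C = P * diagonal_part xs * Q + P * nilpotent_part xs * Q"
      unfolding w(3) jordan_matrix_eq_parts
      by (simp add: mult_add_distrib_mat[of _ n n _ n] add_mult_distrib_mat[of _ n n _ _ n])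
    show "P * diagonal_part xs * Q * (P * nilpotent_part xs * Q) =
      P * nilpotent_part xs * Q * (P * diagonal_part xs * Q)"
      by (simp add: cancel diagonal_part_commute)
    have "similar_mat (P * diagonal_part xs * Q) (diagonal_part xs)"
      by (rule similar_matI[of _ _ P Q n]) (use w in auto)
    then show "semisimple_mat (P * diagonal_part xs * Q)"
      unfolding semisimple_mat_def using diagonal_part_diagonal by blast
    have "similar_mat_wit (P * nilpotent_part xs * Q) (nilpotent_part xs) P Q"
      by (rule similar_mat_witI) (use w in auto)
    moreover have "\<forall>x\<in>set xs. fst x \<le> n"
      using n member_le_sum_list[of _ "map fst xs"] by auto
    from nilpotent_part_pow_eq_0[OF this] have "nilpotent_part xs ^\<^sub>m n = 0\<^sub>m n n" using n by simp
    ultimately have "(P * nilpotent_part xs * Q) ^\<^sub>m n = 0\<^sub>m n n"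
      by (subst similar_mat_wit_pow_id) (auto simp: left_mult_zero_mat[of _ n n] right_mult_zero_mat[of _ n n])
    then show "nilpotent_mat (P * nilpotent_part xs * Q)"
      unfolding nilpotent_mat_def using carrier_matD(1)[OF w(6)] by auto
  qed auto
qed

section \<open>Restriction to an invariant subspace\<close>

lemma mult_mat_unit_vec:
  fixes P :: "'a :: comm_ring_1 mat"
  assumes "P \<in> carrier_mat n k" "j < k"
  shows "P *\<^sub>v unit_vec k j = col P j"
  using assms by (metis col_mult2 col_one one_carrier_mat right_mult_one_mat)

lemma injective_mat_left_cancel:
  fixes P :: "'a :: comm_ring_1 mat"
  assumes P: "P \<in> carrier_mat n k"
    and inj: "\<forall>x\<in>carrier_vec k. P *\<^sub>v x = 0\<^sub>v n \<longrightarrow> x = 0\<^sub>v k"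
    and A: "A \<in> carrier_mat k m" and B: "B \<in> carrier_mat k m" and eq: "P * A = P * B"
  shows "A = B"
proof (rule mat_col_eqI)
  fix j assume "j < dim_col B"
  then have j: "j < m" using B by simp
  have A': "col A j \<in> carrier_vec k" and B': "col B j \<in> carrier_vec k" using A B by auto
  have "P *\<^sub>v (col A j - col B j) = P *\<^sub>v col A j - P *\<^sub>v col B j"
    by (rule mult_minus_distrib_mat_vec[OF P A' B'])
  also have "P *\<^sub>v col A j = P *\<^sub>v col B j"
    unfolding col_mult2[OF P A j, symmetric] col_mult2[OF P B j, symmetric] eq ..
  also have "P *\<^sub>v col B j - P *\<^sub>v col B j = 0\<^sub>v n"
    using mult_mat_vec_carrier[OF P B'] by auto
  finally have "col A j - col B j = 0\<^sub>v k" using inj A' B' by simp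
  then have "col A j $ i - col B j $ i = 0" if "i < k" for i
    using that A' B' by (metis index_minus_vec(1) index_zero_vec(1) carrier_vecD)
  then show "col A j = col B j" using A B by (intro eq_vecI) auto
qed (use A B in auto)

lemma image_mat_factor:
  fixes P :: "'a :: comm_ring_1 mat"
  assumes P: "P \<in> carrier_mat n k" and P': "P' \<in> carrier_mat n l"
    and sub: "(\<lambda>x. P' *\<^sub>v x) ` carrier_vec l \<subseteq> (\<lambda>x. P *\<^sub>v x) ` carrier_vec k"
  shows "\<exists>Q\<in>carrier_mat k l. P' = P * Q"
proof -
  have "\<exists>x\<in>carrier_vec k. col P' j = P *\<^sub>v x" if "j < l" for j
  proof -
    have "col P' j = P' *\<^sub>v unit_vec l j" using mult_mat_unit_vec[OF P' that] by simp
    moreover have "P' *\<^sub>v unit_vec l j \<in> (\<lambda>x. P *\<^sub>v x) ` carrier_vec k"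
      by (rule subsetD[OF sub]) simp
    ultimately show ?thesis by auto
  qed
  then obtain f where f: "\<And>j. j < l \<Longrightarrow> f j \<in> carrier_vec k \<and> col P' j = P *\<^sub>v f j" by metis
  define Q where "Q = mat_of_cols k (map f [0..<l])"
  have Q: "Q \<in> carrier_mat k l" unfolding Q_def by (metis length_map length_upt mat_of_cols_carrier(1) diff_zero)
  have col: "col Q j = f j" if "j < l" for j
    unfolding Q_def using that f by (subst col_mat_of_cols) auto
  have "P' = P * Q"
    by (rule mat_col_eqI) (use P P' Q f col in \<open>auto simp: col_mult2\<close>)
  then show ?thesis using Q by blast
qed

text \<open>
  The columns of \<open>P\<close> are a basis of \<open>W\<close>, without repetition, iff \<open>x \<mapsto> P x\<close> is an isomorphism of the
  coordinate space onto \<open>W\<close>. In this form bases can be handled by matrix algebra alone.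
\<close>

lemma (in vec_space) basis_of_subspace_iff:
  assumes W: "submodule class_ring W V" and P: "P \<in> carrier_mat n k"
  shows "distinct (cols P) \<and> vectorspace.basis class_ring (V\<lparr>carrier := W\<rparr>) (set (cols P)) \<longleftrightarrow>
    W = (\<lambda>x. P *\<^sub>v x) ` carrier_vec k \<and> (\<forall>x\<in>carrier_vec k. P *\<^sub>v x = 0\<^sub>v n \<longrightarrow> x = 0\<^sub>v k)"
proof -
  have sub: "subspace class_ring W V"
    using W vec_vs unfolding subspace_def by auto
  interpret w: vectorspace class_ring "V\<lparr>carrier := W\<rparr>" by (rule subspace_is_vs[OF sub])
  have cols: "set (cols P) \<subseteq> carrier_vec n" using P cols_dim by blast
  have span: "span (set (cols P)) = (\<lambda>x. P *\<^sub>v x) ` carrier_vec k"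
    using col_space_eq[OF P] P unfolding col_space_def by auto
  have own: "set (cols P) \<subseteq> span (set (cols P))" by (rule in_own_span) (use cols in simp)
  have 1: "w.basis (set (cols P)) \<longleftrightarrow> lin_indpt (set (cols P)) \<and> span (set (cols P)) = W"
  proof (cases "set (cols P) \<subseteq> W")
    case True
    show ?thesis
      unfolding w.basis_def span_li_not_depend[OF True W] using True by auto
  next
    case False
    then show ?thesis using own unfolding w.basis_def by auto
  qed
  have 2: "distinct (cols P) \<and> lin_indpt (set (cols P)) \<longleftrightarrow>
      (\<forall>x\<in>carrier_vec k. P *\<^sub>v x = 0\<^sub>v n \<longrightarrow> x = 0\<^sub>v k)" (is "?L \<longleftrightarrow> ?R")
  proof
    assume ?L then show ?R using lin_depI[OF P] by blast
  next
    assume R: ?R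
    have d: "distinct (cols P)"
    proof (rule ccontr)
      assume "\<not> distinct (cols P)"
      then obtain i j where ij: "i < k" "j < k" "i \<noteq> j" "col P i = col P j"
        using P unfolding distinct_conv_nth by auto
      have "P *\<^sub>v (unit_vec k i - unit_vec k j) = P *\<^sub>v unit_vec k i - P *\<^sub>v unit_vec k j"
        by (rule mult_minus_distrib_mat_vec[OF P]) auto
      also have "\<dots> = 0\<^sub>v n" using ij mult_mat_unit_vec[OF P] P by auto
      finally have "unit_vec k i - unit_vec k j = (0\<^sub>v k :: 'a vec)" using R by simp
      then have "(unit_vec k i - unit_vec k j) $ i = (0\<^sub>v k :: 'a vec) $ i" by simp
      then show False using ij by simp
    qed
    moreover have "lin_indpt (set (cols P))" using lin_depE[OF P _ d] R by metis
    ultimately show ?L by blast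
  qed
  show ?thesis using 1 2 span by blast
qed

text \<open>
  The change of basis between \<open>P\<close> and \<open>P'\<close> is a matrix \<open>Q\<close> with \<open>P' = P Q\<close>; injectivity of \<open>P\<close> makes it
  invertible and turns \<open>A P = P M\<close>, \<open>A P' = P' M'\<close> into \<open>Q M' = M Q\<close>.
\<close>

lemma restriction_matrix_similar:
  assumes A: "A \<in> carrier_mat n n"
    and W: "submodule class_ring W (module_vec TYPE(complex) n)"
    and M: "restriction_matrix A W M" and M': "restriction_matrix A W M'"
  shows "similar_mat M M'"
proof -
  interpret vec_space "TYPE(complex)" n .
  have sub: "subspace class_ring W V" using W vec_vs unfolding subspace_def by auto
  interpret w: vectorspace class_ring "V\<lparr>carrier := W\<rparr>" by (rule subspace_is_vs[OF sub])
  obtain k P where P: "P \<in> carrier_mat n k" "distinct (cols P)" "w.basis (set (cols P))"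
      and M: "M \<in> carrier_mat k k" "A * P = P * M"
    using M A unfolding restriction_matrix_def Let_def by auto
  obtain l P' where P': "P' \<in> carrier_mat n l" "distinct (cols P')" "w.basis (set (cols P'))"
      and M': "M' \<in> carrier_mat l l" "A * P' = P' * M'"
    using M' A unfolding restriction_matrix_def Let_def by auto
  have "l = k"
    using w.dim_basis[OF _ P(3)] w.dim_basis[OF _ P'(3)] distinct_card[OF P(2)] distinct_card[OF P'(2)]
      P(1) P'(1) by simp
  have 1: "W = (\<lambda>x. P *\<^sub>v x) ` carrier_vec k" "\<forall>x\<in>carrier_vec k. P *\<^sub>v x = 0\<^sub>v n \<longrightarrow> x = 0\<^sub>v k"
    using basis_of_subspace_iff[OF W P(1)] P by auto
  have 2: "W = (\<lambda>x. P' *\<^sub>v x) ` carrier_vec k"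
    using basis_of_subspace_iff[OF W P'(1)] P' \<open>l = k\<close> by auto
  note P' = P'[unfolded \<open>l = k\<close>] and M' = M'[unfolded \<open>l = k\<close>]
  obtain Q where Q: "Q \<in> carrier_mat k k" "P' = P * Q"
    using image_mat_factor[OF P(1) P'(1)] unfolding 1(1)[symmetric] 2[symmetric] by blast
  obtain Q' where Q': "Q' \<in> carrier_mat k k" "P = P' * Q'"
    using image_mat_factor[OF P'(1) P(1)] unfolding 1(1)[symmetric] 2[symmetric] by blast
  have "P * (Q * Q') = P * 1\<^sub>m k"
    unfolding assoc_mult_mat[OF P(1) Q(1) Q'(1), symmetric] Q(2)[symmetric] Q'(2)[symmetric]
    using P(1) by simp
  then have QQ': "Q * Q' = 1\<^sub>m k"
    by (rule injective_mat_left_cancel[OF P(1) 1(2), rotated 2]) (use Q(1) Q'(1) in auto)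
  have Q'Q: "Q' * Q = 1\<^sub>m k" by (rule mat_mult_left_right_inverse[OF Q(1) Q'(1) QQ'])
  have "P * (Q * M') = A * (P * Q)"
    unfolding assoc_mult_mat[OF P(1) Q(1) M'(1), symmetric] Q(2)[symmetric] M'(2) ..
  also have "\<dots> = P * (M * Q)"
    unfolding assoc_mult_mat[OF A P(1) Q(1), symmetric] M(2) by (rule assoc_mult_mat[OF P(1) M(1) Q(1)])
  finally have "Q * M' = M * Q"
    by (rule injective_mat_left_cancel[OF P(1) 1(2), rotated 2]) (use Q(1) M(1) M'(1) in auto)
  then have "Q * M' * Q' = M"
    using assoc_mult_mat[OF M(1) Q(1) Q'(1)] QQ' M(1) by simp
  then show ?thesis
    by (intro similar_matI[of _ _ Q Q' k]) (use Q(1) Q'(1) M(1) M'(1) QQ' Q'Q in auto)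
qed

text \<open>
  The definition of \<^const>\<open>block_sizes\<close> is a definite description. Its value is known as soon as one
  restriction matrix in Jordan form is known, since all restriction matrices are similar.
\<close>

lemma block_sizes_eqI:
  assumes A: "A \<in> carrier_mat n n"
    and W: "submodule class_ring W (module_vec TYPE(complex) n)"
    and M: "restriction_matrix A W M" and jnf: "jordan_nf M (map (\<lambda>k. (k, 0)) ds)"
  shows "block_sizes A W = rev (sort ds)"
  unfolding block_sizes_def
proof (rule the_equality)
  have "jordan_nf M (map (\<lambda>k. (k, 0)) (rev (sort ds)))"
    by (rule jordan_nf_cong_mset[OF jnf]) simp
  then show "sorted_wrt (\<ge>) (rev (sort ds)) \<and>
      (\<exists>M. restriction_matrix A W M \<and> jordan_nf M (map (\<lambda>k. (k, 0)) (rev (sort ds))))"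
    using M by (auto simp: sorted_wrt_rev)
next
  fix es :: "nat list"
  assume "sorted_wrt (\<ge>) es \<and> (\<exists>M. restriction_matrix A W M \<and> jordan_nf M (map (\<lambda>k. (k, 0)) es))"
  then obtain M' where es: "sorted_wrt (\<ge>) es" and M': "restriction_matrix A W M'"
      and jnf': "jordan_nf M' (map (\<lambda>k. (k, 0)) es)" by blast
  have "jordan_nf M (map (\<lambda>k. (k, 0)) es)"
    by (rule jordan_nf_similar[OF restriction_matrix_similar[OF A W M M'] jnf'])
  from jordan_nf_unique_mset[OF this jnf]
  have "image_mset fst (mset (map (\<lambda>k. (k, 0::complex)) es)) =
        image_mset fst (mset (map (\<lambda>k. (k, 0::complex)) ds))" by simp
  then have "mset es = mset ds" by (simp add: mset_map[symmetric] o_def del: mset_map)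
  then have "sort ds = rev es" using es by (intro properties_for_sort) (auto simp: sorted_wrt_rev)
  then show "es = rev (sort ds)" by simp
qed

section \<open>The triple of a matrix in terms of its Jordan blocks\<close>

definition blocks_at :: "(nat \<times> 'a) list \<Rightarrow> 'a \<Rightarrow> nat list" where
  "blocks_at xs \<mu> = map fst (filter (\<lambda>x. snd x = \<mu>) xs)"

lemma submodule_eigenspace:
  assumes "S \<in> carrier_mat n n"
  shows "submodule class_ring (eigenspace S \<mu>) (module_vec TYPE(complex) n)"
proof -
  interpret vec_space "TYPE(complex)" n .
  show ?thesis
    by (unfold_locales)
       (use assms in \<open>auto simp: eigenspace_def mult_add_distrib_mat_vec[of _ n n] smult_add_distrib_vec[of _ n]
          mult_mat_vec smult_smult_assoc mult.commute\<close>)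
qed

text \<open>
  With the blocks for \<open>\<mu>\<close> listed first, the \<open>\<mu>\<close>-eigenspace of the diagonal part is spanned by the first
  \<open>k\<close> unit vectors, which are the columns of \<open>E\<close>. So the first \<open>k\<close> columns of the conjugating matrix \<open>P\<close>,
  i.e. \<open>P E\<close>, form a basis of the eigenspace of \<open>S\<close>, and \<open>N\<close> acts on it by the nilpotent parts of the
  blocks for \<open>\<mu>\<close>.
\<close>

lemma block_sizes_of_jordan_nf_append:
  assumes C: "C \<in> carrier_mat n n" and jnf: "jordan_nf C (map (\<lambda>k. (k, \<mu>)) ds @ ys)"
    and \<mu>: "\<mu> \<notin> snd ` set ys" and SN: "jordan_decomposition C = (S, N)"
  shows "block_sizes N (eigenspace S \<mu>) = rev (sort ds)"
proof -
  let ?ds = "map (\<lambda>k. (k, \<mu>)) ds" and ?es = "map (\<lambda>k. (k, 0 :: complex)) ds"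
  define k where "k = sum_list ds"
  define m where "m = sum_list (map fst ys)"
  let ?xs = "?ds @ ys"
  obtain P Q where w: "similar_mat_wit C (jordan_matrix ?xs) P Q"
    using jnf unfolding jordan_nf_def similar_mat_def by blast
  have S: "S = P * diagonal_part ?xs * Q" and N: "N = P * nilpotent_part ?xs * Q"
    using jordan_decomposition_of_wit[OF C w] SN by auto
  note w = similar_mat_witD2[OF C w]
  have ds: "sum_list (map fst ?ds) = k" by (simp add: k_def o_def)
  have n: "n = k + m" using w(5) ds by (auto simp: m_def)
  let ?D = "diagonal_part ?xs" and ?N = "nilpotent_part ?xs"
  define E :: "complex mat" where "E = four_block_mat (1\<^sub>m k) (0\<^sub>m k 0) (0\<^sub>m m k) (0\<^sub>m m 0)"
  let ?M = "nilpotent_part ?ds"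
  have M_eq: "?M = jordan_matrix ?es" by (simp add: nilpotent_part_def o_def)
  have M: "?M \<in> carrier_mat k k" using nilpotent_part_carrier[of ?ds] unfolding ds .
  have E: "E \<in> carrier_mat n k" unfolding E_def n by (rule carrier_matI) auto
  have D: "?D \<in> carrier_mat n n" and N': "?N \<in> carrier_mat n n"
    using diagonal_part_carrier[of ?xs] nilpotent_part_carrier[of ?xs]
    unfolding n map_append sum_list_append ds m_def by auto
  have NE: "?N * E = E * ?M"
  proof -
    have 1: "?M = four_block_mat ?M (0\<^sub>m k 0) (0\<^sub>m 0 k) (0\<^sub>m 0 0)"
      by (rule eq_matI) (use M in auto)
    have "?N = four_block_mat ?M (0\<^sub>m k m) (0\<^sub>m m k) (nilpotent_part ys)"
      unfolding nilpotent_part_append ds m_def ..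
    moreover have ys: "nilpotent_part ys \<in> carrier_mat m m" unfolding m_def by simp
    ultimately have "?N * E = four_block_mat ?M (0\<^sub>m k 0) (0\<^sub>m m k) (0\<^sub>m m 0)"
      unfolding E_def using M
      by (simp add: mult_four_block_mat[of _ k k _ m _ m _ _ k _ 0] right_mult_one_mat[OF M]
          right_mult_zero_mat[OF M] right_mult_zero_mat[OF ys])
    also have "\<dots> = E * four_block_mat ?M (0\<^sub>m k 0) (0\<^sub>m 0 k) (0\<^sub>m 0 0)"
      unfolding E_def using M
      by (subst mult_four_block_mat[of _ k k _ 0 _ m _ _ k _ 0])
         (auto simp: left_mult_one_mat[OF M] left_mult_zero_mat[OF M] right_add_zero_mat[OF M])
    also have "\<dots> = E * ?M" unfolding 1[symmetric] ..
    finally show ?thesis .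
  qed
  have Dv: "(?D *\<^sub>v x) $ i = ?D $$ (i, i) * x $ i" if "x \<in> carrier_vec n" "i < n" for x i
  proof -
    have "(?D *\<^sub>v x) $ i = (\<Sum>j = 0..<n. ?D $$ (i, j) * x $ j)"
      using that D by (auto simp: scalar_prod_def intro!: sum.cong)
    also have "\<dots> = (\<Sum>j = 0..<n. if j = i then ?D $$ (i, i) * x $ i else 0)"
      using that D diagonal_part_diagonal[of ?xs] by (intro sum.cong) (auto simp: diagonal_mat_def)
    finally show ?thesis using that by simp
  qed
  have D_diag: "?D $$ (i, i) = \<mu> \<longleftrightarrow> i < k" if i: "i < n" for i
  proof (cases "i < k")
    case True
    have "?D $$ (i, i) = diagonal_part ?ds $$ (i, i)"
      unfolding diagonal_part_append using True i ds n m_def by simp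
    moreover have "diagonal_part ?ds $$ (i, i) \<in> snd ` set ?ds"
      by (rule diagonal_part_entry) (use True ds in auto)
    ultimately show ?thesis using True by auto
  next
    case False
    have "?D $$ (i, i) = diagonal_part ys $$ (i - k, i - k)"
      unfolding diagonal_part_append using False i ds n m_def by simp
    moreover have "diagonal_part ys $$ (i - k, i - k) \<in> snd ` set ys"
      by (rule diagonal_part_entry) (use False i n m_def in auto)
    ultimately show ?thesis using False \<mu> by auto
  qed
  have Ev: "E *\<^sub>v y = vec n (\<lambda>i. if i < k then y $ i else 0)" if "y \<in> carrier_vec k" for y
  proof (rule eq_vecI)
    fix i assume "i < dim_vec (vec n (\<lambda>i. if i < k then y $ i else 0))"
    then have i: "i < n" by simp
    have "(E *\<^sub>v y) $ i = (\<Sum>j = 0..<k. E $$ (i, j) * y $ j)"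
      using that E i by (auto simp: scalar_prod_def intro!: sum.cong)
    also have "\<dots> = (\<Sum>j = 0..<k. if j = i then y $ j else 0)"
      using i by (intro sum.cong) (auto simp: E_def n)
    finally show "(E *\<^sub>v y) $ i = vec n (\<lambda>i. if i < k then y $ i else 0) $ i" using i by simp
  qed (use E in simp)
  have D_eigen: "?D *\<^sub>v x = \<mu> \<cdot>\<^sub>v x \<longleftrightarrow> (\<exists>y\<in>carrier_vec k. x = E *\<^sub>v y)" if x: "x \<in> carrier_vec n" for x
  proof
    assume *: "?D *\<^sub>v x = \<mu> \<cdot>\<^sub>v x"
    have "x $ i = 0" if "i < n" "\<not> i < k" for i
      using arg_cong[OF *, of "\<lambda>v. v $ i"] Dv[OF x that(1)] D_diag[OF that(1)] that x by auto
    then have "x = E *\<^sub>v vec k (\<lambda>i. x $ i)"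
      using x by (subst Ev) (auto intro!: eq_vecI)
    then show "\<exists>y\<in>carrier_vec k. x = E *\<^sub>v y" by (metis vec_carrier)
  next
    assume "\<exists>y\<in>carrier_vec k. x = E *\<^sub>v y"
    then obtain y where y: "y \<in> carrier_vec k" "x = vec n (\<lambda>i. if i < k then y $ i else 0)"
      using Ev by auto
    have "(?D *\<^sub>v x) $ i = (\<mu> \<cdot>\<^sub>v x) $ i" if "i < n" for i
      using Dv[OF x that] D_diag[OF that] that y by (cases "i < k") auto
    then show "?D *\<^sub>v x = \<mu> \<cdot>\<^sub>v x" using D x by (intro eq_vecI) auto
  qed
  have SC: "S \<in> carrier_mat n n" and NC: "N \<in> carrier_mat n n" unfolding S N using w D N' by auto
  have QP: "Q *\<^sub>v (P *\<^sub>v x) = x" "P *\<^sub>v (Q *\<^sub>v x) = x" if "x \<in> carrier_vec n" for x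
    using that w by (simp_all add: assoc_mult_mat_vec[symmetric, of _ n n _ n])
  have S_vec: "S *\<^sub>v x = P *\<^sub>v (?D *\<^sub>v (Q *\<^sub>v x))" if "x \<in> carrier_vec n" for x
    unfolding S using that w D by (simp add: assoc_mult_mat_vec[of _ n n _ n])
  have eigen: "eigenspace S \<mu> = (\<lambda>y. (P * E) *\<^sub>v y) ` carrier_vec k"
  proof (intro equalityI subsetI)
    fix v assume "v \<in> eigenspace S \<mu>"
    then have v: "v \<in> carrier_vec n" "S *\<^sub>v v = \<mu> \<cdot>\<^sub>v v" using SC by (auto simp: eigenspace_def)
    have Qv: "Q *\<^sub>v v \<in> carrier_vec n" using w v by auto
    have "?D *\<^sub>v (Q *\<^sub>v v) = Q *\<^sub>v (S *\<^sub>v v)"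
      unfolding S_vec[OF v(1)] by (subst QP(1)) (use D Qv in auto)
    also have "\<dots> = \<mu> \<cdot>\<^sub>v (Q *\<^sub>v v)" unfolding v(2) using mult_mat_vec[OF w(7) v(1)] .
    finally obtain y where y: "y \<in> carrier_vec k" "Q *\<^sub>v v = E *\<^sub>v y" using D_eigen[OF Qv] by blast
    have "v = P *\<^sub>v (E *\<^sub>v y)" using QP(2)[OF v(1)] y by simp
    also have "\<dots> = (P * E) *\<^sub>v y" using assoc_mult_mat_vec[OF w(6) E y(1)] by simp
    finally show "v \<in> (\<lambda>y. (P * E) *\<^sub>v y) ` carrier_vec k" using y(1) by blast
  next
    fix v assume "v \<in> (\<lambda>y. (P * E) *\<^sub>v y) ` carrier_vec k"
    then obtain y where y: "y \<in> carrier_vec k" "v = (P * E) *\<^sub>v y" by blast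
    have Ey: "E *\<^sub>v y \<in> carrier_vec n" using E y by auto
    have v: "v = P *\<^sub>v (E *\<^sub>v y)" using assoc_mult_mat_vec[OF w(6) E y(1)] y by simp
    have vc: "v \<in> carrier_vec n" unfolding v using w(6) Ey by auto
    have "S *\<^sub>v v = P *\<^sub>v (?D *\<^sub>v (E *\<^sub>v y))" using S_vec[OF vc] QP(1)[OF Ey] v by simp
    also have "?D *\<^sub>v (E *\<^sub>v y) = \<mu> \<cdot>\<^sub>v (E *\<^sub>v y)" using D_eigen[OF Ey] y(1) by blast
    also have "P *\<^sub>v \<dots> = \<mu> \<cdot>\<^sub>v v" unfolding v by (rule mult_mat_vec[OF w(6) Ey])
    finally show "v \<in> eigenspace S \<mu>" using vc SC by (auto simp: eigenspace_def)
  qed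
  have inj: "\<forall>y\<in>carrier_vec k. (P * E) *\<^sub>v y = 0\<^sub>v n \<longrightarrow> y = 0\<^sub>v k"
  proof (intro ballI impI)
    fix y :: "complex vec" assume y: "y \<in> carrier_vec k" "(P * E) *\<^sub>v y = 0\<^sub>v n"
    have Ey: "E *\<^sub>v y \<in> carrier_vec n" using E y by auto
    have "E *\<^sub>v y = Q *\<^sub>v (P *\<^sub>v (E *\<^sub>v y))" using QP(1)[OF Ey] by simp
    also have "P *\<^sub>v (E *\<^sub>v y) = 0\<^sub>v n" using assoc_mult_mat_vec[OF w(6) E y(1)] y(2) by simp
    also have "Q *\<^sub>v 0\<^sub>v n = 0\<^sub>v n" using w(7) by (intro eq_vecI) auto
    finally have *: "vec n (\<lambda>i. if i < k then y $ i else 0) = 0\<^sub>v n" using Ev[OF y(1)] by simp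
    have "y $ i = 0" if "i < k" for i
      using arg_cong[OF *, of "\<lambda>v. v $ i"] that n by simp
    then show "y = 0\<^sub>v k" using y(1) by (intro eq_vecI) auto
  qed
  have PE: "P * E \<in> carrier_mat n k" using w(6) E by auto
  have NPE: "N * (P * E) = (P * E) * ?M"
  proof -
    have "N * (P * E) = P * ?N * (Q * (P * E))"
      unfolding N by (rule assoc_mult_mat[OF mult_carrier_mat[OF w(6) N'] w(7) PE])
    also have "Q * (P * E) = E"
      using assoc_mult_mat[OF w(7,6) E] w(2) E by simp
    also have "P * ?N * E = P * (?N * E)" by (rule assoc_mult_mat[OF w(6) N' E])
    also have "\<dots> = (P * E) * ?M" unfolding NE by (rule assoc_mult_mat[symmetric, OF w(6) E M])
    finally show ?thesis .
  qed
  note sub = submodule_eigenspace[OF SC, of \<mu>]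
  have "distinct (cols (P * E)) \<and> vectorspace.basis class_ring
      ((module_vec TYPE(complex) n)\<lparr>carrier := eigenspace S \<mu>\<rparr>) (set (cols (P * E)))"
    using vec_space.basis_of_subspace_iff[OF sub PE] eigen inj by blast
  then have r: "restriction_matrix N (eigenspace S \<mu>) ?M"
    unfolding restriction_matrix_def Let_def using NC PE M NPE by auto
  have "0 \<notin> set ds" using jnf unfolding jordan_nf_def by force
  then have "jordan_nf ?M ?es"
    unfolding M_eq jordan_nf_def using similar_mat_refl[OF jordan_matrix_carrier] by auto
  from block_sizes_eqI[OF NC sub r this] show ?thesis .
qed

lemma eigenvalue_iff_jordan_nf:
  fixes C :: "'a :: field mat"
  assumes C: "C \<in> carrier_mat n n" and jnf: "jordan_nf C xs"
  shows "eigenvalue C \<mu> \<longleftrightarrow> \<mu> \<in> snd ` set xs"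
proof -
  have pos: "\<And>x. x \<in> set xs \<Longrightarrow> fst x \<noteq> 0" using jnf unfolding jordan_nf_def by (metis image_eqI)
  have "char_poly C \<noteq> 0" using degree_monic_char_poly[OF C] by (metis coeff_0 zero_neq_one)
  then have "eigenvalue C \<mu> \<longleftrightarrow> sum_list (blocks_at xs \<mu>) \<noteq> 0"
    unfolding eigenvalue_root_char_poly[OF C] order_root jordan_nf_order[OF jnf] blocks_at_def by simp
  also have "\<dots> \<longleftrightarrow> \<mu> \<in> snd ` set xs"
    using pos by (force simp: blocks_at_def sum_list_eq_0_iff)
  finally show ?thesis .
qed

text \<open>
  The order of the blocks is irrelevant up to similarity, so for each \<open>\<mu>\<close> the blocks for \<open>\<mu>\<close> may be moved
  to the front; the pair \<open>(S, N)\<close> stays the same, being unique.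
\<close>

theorem jordan_triple_of_jordan_nf:
  assumes C: "C \<in> carrier_mat n n" and jnf: "jordan_nf C xs"
  shows "jordan_triple C = (snd ` set xs,
    restrict (\<lambda>\<mu>. sum_list (blocks_at xs \<mu>)) (snd ` set xs),
    restrict (\<lambda>\<mu>. rev (sort (blocks_at xs \<mu>))) (snd ` set xs))"
proof -
  obtain P Q where w: "similar_mat_wit C (jordan_matrix xs) P Q"
    using jnf unfolding jordan_nf_def similar_mat_def by blast
  define S where "S = P * diagonal_part xs * Q"
  define N where "N = P * nilpotent_part xs * Q"
  have SN: "jordan_decomposition C = (S, N)"
    using jordan_decomposition_of_wit[OF C w] by (simp add: S_def N_def)
  note w = similar_mat_witD2[OF C w]
  have n: "sum_list (map fst xs) = n" using w(5) by auto
  have D: "diagonal_part xs \<in> carrier_mat n n" using n diagonal_part_carrier[of xs] by auto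
  have S: "S \<in> carrier_mat n n" unfolding S_def using w D by auto
  have "similar_mat S (diagonal_part xs)"
    by (rule similar_matI[of _ _ P Q n]) (use w D S in \<open>auto simp: S_def\<close>)
  then have "char_poly S = char_poly (jordan_matrix xs)"
    by (simp add: char_poly_similar char_poly_diagonal_part)
  also have "\<dots> = char_poly C"
    using jnf char_poly_similar unfolding jordan_nf_def by metis
  finally have cp: "char_poly S = char_poly C" .
  have order: "Polynomial.order \<mu> (char_poly S) = sum_list (blocks_at xs \<mu>)" for \<mu>
    unfolding cp blocks_at_def by (rule jordan_nf_order[OF jnf])
  have "spectrum C = snd ` set xs"
    by (rule Set.set_eqI) (simp only: spectrum_def mem_Collect_eq eigenvalue_iff_jordan_nf[OF C jnf])
  then have spec: "spectrum S = snd ` set xs"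
    unfolding spectrum_root_char_poly[OF S] spectrum_root_char_poly[OF C] cp .
  have "block_sizes N (eigenspace S \<mu>) = rev (sort (blocks_at xs \<mu>))" for \<mu>
  proof (rule block_sizes_of_jordan_nf_append[OF C _ _ SN])
    let ?ys = "filter (\<lambda>x. snd x \<noteq> \<mu>) xs"
    have "map (\<lambda>k. (k, \<mu>)) (blocks_at xs \<mu>) = filter (\<lambda>x. snd x = \<mu>) xs"
      unfolding blocks_at_def map_map by (rule map_idI) auto
    then have "mset (map (\<lambda>k. (k, \<mu>)) (blocks_at xs \<mu>) @ ?ys) = mset xs" by simp
    then show "jordan_nf C (map (\<lambda>k. (k, \<mu>)) (blocks_at xs \<mu>) @ ?ys)"
      by (intro jordan_nf_cong_mset[OF jnf]) simp
    show "\<mu> \<notin> snd ` set ?ys" by auto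
  qed
  then show ?thesis
    unfolding jordan_triple_def SN Let_def prod.case spec order by simp
qed

section \<open>The orthogonal group and its Lie algebra as matrix equations\<close>

text \<open>The Gram matrix of the form in the basis \<open>E\<^sub>1,\<dots>,E\<^sub>p,F\<^sub>1,\<dots>,F\<^sub>p\<close>; it is its own inverse.\<close>

definition gram :: "nat \<Rightarrow> complex mat" where
  "gram p = four_block_mat (0\<^sub>m p p) (1\<^sub>m p) (1\<^sub>m p) (0\<^sub>m p p)"

lemma gram_carrier [simp]: "gram p \<in> carrier_mat (2 * p) (2 * p)"
  by (rule carrier_matI) (auto simp: gram_def)

lemma gram_dim [simp]: "dim_row (gram p) = 2 * p" "dim_col (gram p) = 2 * p"
  by (auto simp: gram_def)

lemma gram_transpose [simp]: "(gram p)\<^sup>T = gram p"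
  by (rule eq_matI) (auto simp: gram_def)

lemma gram_square [simp]: "gram p * gram p = 1\<^sub>m (2 * p)"
proof -
  have "gram p * gram p = 1\<^sub>m (p + p)"
    unfolding gram_def by (subst mult_four_block_mat[of _ p p _ p _ p _ _ p _ p]) auto
  then show ?thesis by (simp add: mult_2)
qed

lemma bform_gram:
  assumes "x \<in> carrier_vec (2 * p)" "y \<in> carrier_vec (2 * p)"
  shows "bform p x y = x \<bullet> (gram p *\<^sub>v y)"
proof -
  have G: "(gram p *\<^sub>v y) $ i = (if i < p then y $ (p + i) else y $ (i - p))" if "i < 2 * p" for i
  proof -
    have "(gram p *\<^sub>v y) $ i = (\<Sum>j = 0..<2 * p. gram p $$ (i, j) * y $ j)"
      using that assms gram_carrier[of p] by (auto simp: scalar_prod_def intro!: sum.cong)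
    also have "\<dots> = (\<Sum>j = 0..<2 * p. if j = (if i < p then p + i else i - p) then y $ j else 0)"
      using that by (intro sum.cong) (auto simp: gram_def)
    finally show ?thesis using that by (cases "i < p") auto
  qed
  have "x \<bullet> (gram p *\<^sub>v y) = (\<Sum>i = 0..<2 * p. x $ i * (if i < p then y $ (p + i) else y $ (i - p)))"
    using gram_carrier[of p] unfolding scalar_prod_def by (intro sum.cong) (auto simp: G simp del: index_mult_mat_vec)
  also have "\<dots> = (\<Sum>i = 0..<p. x $ i * y $ (p + i)) + (\<Sum>i = p..<p + p. x $ i * y $ (i - p))"
    unfolding mult_2 by (subst sum.atLeastLessThan_concat[of 0 p "p + p", symmetric]) auto
  also have "(\<Sum>i = p..<p + p. x $ i * y $ (i - p)) = (\<Sum>i = 0..<p. x $ (p + i) * y $ i)"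
    using sum.shift_bounds_nat_ivl[of "\<lambda>i. x $ i * y $ (i - p)" 0 p p] by (simp add: add.commute)
  finally show ?thesis unfolding bform_def sum.distrib by (simp add: atLeast0LessThan)
qed

lemma mat_eqI_bilinear:
  fixes A B :: "'a :: comm_ring_1 mat"
  assumes A: "A \<in> carrier_mat n n" and B: "B \<in> carrier_mat n n"
    and eq: "\<And>x y. x \<in> carrier_vec n \<Longrightarrow> y \<in> carrier_vec n \<Longrightarrow> x \<bullet> (A *\<^sub>v y) = x \<bullet> (B *\<^sub>v y)"
  shows "A = B"
proof (rule eq_matI)
  have *: "unit_vec n i \<bullet> (M *\<^sub>v unit_vec n j) = M $$ (i, j)"
    if "M \<in> carrier_mat n n" "i < n" "j < n" for M :: "'a mat" and i j
  proof -
    show ?thesis unfolding mult_mat_unit_vec[OF that(1,3)] using that by (simp add: scalar_prod_left_unit[of _ n])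
  qed
  fix i j assume "i < dim_row B" "j < dim_col B"
  then show "A $$ (i, j) = B $$ (i, j)"
    using *[OF A, of i j] *[OF B, of i j] eq[of "unit_vec n i" "unit_vec n j"] B by auto
qed (use A B in auto)

lemma bform_mult_left:
  assumes "A \<in> carrier_mat (2 * p) (2 * p)" "x \<in> carrier_vec (2 * p)" "y \<in> carrier_vec (2 * p)"
  shows "bform p (A *\<^sub>v x) y = x \<bullet> ((A\<^sup>T * gram p) *\<^sub>v y)"
proof -
  have Gy: "gram p *\<^sub>v y \<in> carrier_vec (2 * p)"
    by (rule mult_mat_vec_carrier[OF gram_carrier assms(3)])
  have "bform p (A *\<^sub>v x) y = (A *\<^sub>v x) \<bullet> (gram p *\<^sub>v y)"
    by (rule bform_gram[OF mult_mat_vec_carrier[OF assms(1,2)] assms(3)])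
  also have "\<dots> = (gram p *\<^sub>v y) \<bullet> (A *\<^sub>v x)"
    by (rule comm_scalar_prod[OF mult_mat_vec_carrier[OF assms(1,2)] Gy])
  also have "\<dots> = (A\<^sup>T *\<^sub>v (gram p *\<^sub>v y)) \<bullet> x"
    using transpose_vec_mult_scalar[OF assms(1,2) Gy] by simp
  also have "\<dots> = x \<bullet> (A\<^sup>T *\<^sub>v (gram p *\<^sub>v y))"
    using assms Gy by (intro comm_scalar_prod[of _ "2 * p"]) auto
  also have "A\<^sup>T *\<^sub>v (gram p *\<^sub>v y) = (A\<^sup>T * gram p) *\<^sub>v y"
    by (rule assoc_mult_mat_vec[symmetric, OF _ gram_carrier assms(3)]) (use assms(1) in simp)
  finally show ?thesis .
qed

lemma orth_lie_algebra_iff: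
  "C \<in> orth_lie_algebra p \<longleftrightarrow> C \<in> carrier_mat (2 * p) (2 * p) \<and> C\<^sup>T * gram p = - (gram p * C)"
proof (cases "C \<in> carrier_mat (2 * p) (2 * p)")
  case C: True
  have GC: "gram p * C \<in> carrier_mat (2 * p) (2 * p)" using mult_carrier_mat[OF gram_carrier C] .
  have CG: "C\<^sup>T * gram p \<in> carrier_mat (2 * p) (2 * p)" using C by (intro mult_carrier_mat[of _ _ "2 * p"]) auto
  have right: "- bform p x (C *\<^sub>v y) = x \<bullet> (- (gram p * C) *\<^sub>v y)"
    if "x \<in> carrier_vec (2 * p)" "y \<in> carrier_vec (2 * p)" for x y
  proof -
    have "- (gram p * C) *\<^sub>v y = - (gram p *\<^sub>v (C *\<^sub>v y))"
      using that C GC by (simp add: assoc_mult_mat_vec[of _ "2 * p" "2 * p" _ "2 * p", symmetric] uminus_mult_mat_vec)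
    moreover have Cy: "C *\<^sub>v y \<in> carrier_vec (2 * p)" by (rule mult_mat_vec_carrier[OF C that(2)])
    moreover have "x \<bullet> - (gram p *\<^sub>v (C *\<^sub>v y)) = - (x \<bullet> (gram p *\<^sub>v (C *\<^sub>v y)))"
      using that(1) by (intro scalar_prod_uminus_right) auto
    ultimately show ?thesis using that by (simp add: bform_gram)
  qed
  show ?thesis
  proof
    assume "C \<in> orth_lie_algebra p"
    then have *: "\<And>x y. x \<in> carrier_vec (2 * p) \<Longrightarrow> y \<in> carrier_vec (2 * p) \<Longrightarrow>
        bform p (C *\<^sub>v x) y = - bform p x (C *\<^sub>v y)" by (simp add: orth_lie_algebra_def)
    have "C\<^sup>T * gram p = - (gram p * C)"
      by (rule mat_eqI_bilinear[OF CG]) (use GC * bform_mult_left[OF C] right in auto)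
    with C show "C \<in> carrier_mat (2 * p) (2 * p) \<and> C\<^sup>T * gram p = - (gram p * C)" by simp
  next
    assume "C \<in> carrier_mat (2 * p) (2 * p) \<and> C\<^sup>T * gram p = - (gram p * C)"
    then show "C \<in> orth_lie_algebra p"
      using bform_mult_left[OF C] right by (auto simp: orth_lie_algebra_def)
  qed
qed (auto simp: orth_lie_algebra_def)

text \<open>
  The adjoint \<open>G U\<^sup>T G\<close> of an isometry is its inverse. This is why isometries are invertible, and it is
  the inverse used to show that they form a group.
\<close>

lemma gram_isometry_inverse:
  assumes U: "U \<in> carrier_mat (2 * p) (2 * p)" and iso: "U\<^sup>T * gram p * U = gram p"
  shows "gram p * U\<^sup>T * gram p * U = 1\<^sub>m (2 * p)" "U * (gram p * U\<^sup>T * gram p) = 1\<^sub>m (2 * p)"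
proof -
  have UT: "U\<^sup>T \<in> carrier_mat (2 * p) (2 * p)" using U by simp
  have V: "gram p * U\<^sup>T * gram p \<in> carrier_mat (2 * p) (2 * p)"
    using mult_carrier_mat[OF mult_carrier_mat[OF gram_carrier UT] gram_carrier] .
  have "gram p * U\<^sup>T * gram p * U = gram p * (U\<^sup>T * gram p * U)"
    using U UT by (simp add: assoc_mult_mat[of _ "2 * p" "2 * p" _ "2 * p" _ "2 * p"])
  then show 1: "gram p * U\<^sup>T * gram p * U = 1\<^sub>m (2 * p)" unfolding iso by simp
  show "U * (gram p * U\<^sup>T * gram p) = 1\<^sub>m (2 * p)"
    by (rule mat_mult_left_right_inverse[OF V U 1])
qed

lemma carrier_orth_group_iff:
  "U \<in> carrier (orth_group p) \<longleftrightarrow> U \<in> carrier_mat (2 * p) (2 * p) \<and> U\<^sup>T * gram p * U = gram p"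
proof (cases "U \<in> carrier_mat (2 * p) (2 * p)")
  case U: True
  have UG: "U\<^sup>T * gram p \<in> carrier_mat (2 * p) (2 * p)" using U by auto
  have UGU: "U\<^sup>T * gram p * U \<in> carrier_mat (2 * p) (2 * p)" using mult_carrier_mat[OF UG U] .
  have *: "bform p (U *\<^sub>v x) (U *\<^sub>v y) = x \<bullet> ((U\<^sup>T * gram p * U) *\<^sub>v y)"
    if "x \<in> carrier_vec (2 * p)" "y \<in> carrier_vec (2 * p)" for x y
    unfolding assoc_mult_mat_vec[OF UG U that(2)] using that U by (intro bform_mult_left) auto
  show ?thesis
  proof
    assume "U \<in> carrier (orth_group p)"
    then have iso: "\<And>x y. x \<in> carrier_vec (2 * p) \<Longrightarrow> y \<in> carrier_vec (2 * p) \<Longrightarrow>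
        bform p (U *\<^sub>v x) (U *\<^sub>v y) = bform p x y" by (simp add: orth_group_def)
    have "U\<^sup>T * gram p * U = gram p"
      by (rule mat_eqI_bilinear[OF UGU gram_carrier]) (use iso * bform_gram in metis)
    with U show "U \<in> carrier_mat (2 * p) (2 * p) \<and> U\<^sup>T * gram p * U = gram p" by simp
  next
    assume "U \<in> carrier_mat (2 * p) (2 * p) \<and> U\<^sup>T * gram p * U = gram p"
    then have iso: "U\<^sup>T * gram p * U = gram p" by simp
    have "invertible_mat U"
      using gram_isometry_inverse[OF U iso] U
      unfolding invertible_mat_def inverts_mat_def by (intro conjI exI[of _ "gram p * U\<^sup>T * gram p"]) auto
    then show "U \<in> carrier (orth_group p)"
      using U * iso bform_gram by (auto simp: orth_group_def)
  qed
qed (auto simp: orth_group_def)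

lemma mult_orth_group [simp]: "(\<otimes>\<^bsub>orth_group p\<^esub>) = (*)"
  and one_orth_group [simp]: "\<one>\<^bsub>orth_group p\<^esub> = 1\<^sub>m (2 * p)"
  by (auto simp: orth_group_def)

lemma group_orth_group: "group (orth_group p)"
proof (rule groupI)
  note assoc = assoc_mult_mat[of _ "2 * p" "2 * p" _ "2 * p" _ "2 * p"]
  note closed = mult_carrier_mat[of _ "2 * p" "2 * p" _ "2 * p"]
  let ?G = "gram p"
  fix U assume "U \<in> carrier (orth_group p)"
  then have U: "U \<in> carrier_mat (2 * p) (2 * p)" and iso: "U\<^sup>T * ?G * U = ?G"
    by (auto simp: carrier_orth_group_iff)
  note inv = gram_isometry_inverse[OF U iso]
  have UT: "U\<^sup>T \<in> carrier_mat (2 * p) (2 * p)" using U by simp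
  { fix V assume "V \<in> carrier (orth_group p)"
    then have V: "V \<in> carrier_mat (2 * p) (2 * p)" and isoV: "V\<^sup>T * ?G * V = ?G"
      by (auto simp: carrier_orth_group_iff)
    have VT: "V\<^sup>T \<in> carrier_mat (2 * p) (2 * p)" using V by simp
    have "(U * V)\<^sup>T * ?G * (U * V) = V\<^sup>T * (U\<^sup>T * ?G * U) * V"
      unfolding transpose_mult[OF U V] using U V UT VT by (simp add: assoc closed)
    then have "(U * V)\<^sup>T * ?G * (U * V) = ?G" unfolding iso isoV .
    then show "U \<otimes>\<^bsub>orth_group p\<^esub> V \<in> carrier (orth_group p)"
      using closed[OF U V] by (simp add: carrier_orth_group_iff)
    fix W assume "W \<in> carrier (orth_group p)"
    then have W: "W \<in> carrier_mat (2 * p) (2 * p)" by (auto simp: carrier_orth_group_iff)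
    show "U \<otimes>\<^bsub>orth_group p\<^esub> V \<otimes>\<^bsub>orth_group p\<^esub> W = U \<otimes>\<^bsub>orth_group p\<^esub> (V \<otimes>\<^bsub>orth_group p\<^esub> W)"
      using assoc[OF U V W] by simp }
  show "\<one>\<^bsub>orth_group p\<^esub> \<otimes>\<^bsub>orth_group p\<^esub> U = U" using left_mult_one_mat[OF U] by simp
  let ?V = "?G * U\<^sup>T * ?G"
  have V: "?V \<in> carrier_mat (2 * p) (2 * p)"
    using mult_carrier_mat[OF mult_carrier_mat[OF gram_carrier UT] gram_carrier] .
  have "?V\<^sup>T * ?G * ?V = ?G * (U * (?G * U\<^sup>T * ?G))"
  proof -
    have "?V\<^sup>T = ?G * U * ?G"
      using U UT by (simp add: transpose_mult[of _ "2 * p" "2 * p" _ "2 * p"] closed assoc)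
    then have "?V\<^sup>T * ?G * ?V = ?G * (U * ((?G * ?G) * (?G * U\<^sup>T * ?G)))"
      using U UT V by (simp add: closed assoc)
    then show ?thesis using V by simp
  qed
  then have "?V\<^sup>T * ?G * ?V = ?G" unfolding inv by simp
  then have "?V \<in> carrier (orth_group p)" using V by (simp add: carrier_orth_group_iff)
  then show "\<exists>V\<in>carrier (orth_group p). V \<otimes>\<^bsub>orth_group p\<^esub> U = \<one>\<^bsub>orth_group p\<^esub>"
    using inv(1) by auto
qed (simp add: carrier_orth_group_iff)

lemma orth_group_carrier_mat: "U \<in> carrier (orth_group p) \<Longrightarrow> U \<in> carrier_mat (2 * p) (2 * p)"
  by (simp add: carrier_orth_group_iff)

lemma inv_orth_group:
  assumes "U \<in> carrier (orth_group p)"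
  shows "inv\<^bsub>orth_group p\<^esub> U \<in> carrier (orth_group p)"
    and "U * inv\<^bsub>orth_group p\<^esub> U = 1\<^sub>m (2 * p)" and "inv\<^bsub>orth_group p\<^esub> U * U = 1\<^sub>m (2 * p)"
  using group.inv_closed[OF group_orth_group assms] group.r_inv[OF group_orth_group assms]
    group.l_inv[OF group_orth_group assms] by simp_all

lemma adjoint_action_mult:
  assumes U: "U \<in> carrier (orth_group p)" and V: "V \<in> carrier (orth_group p)"
    and C: "C \<in> carrier_mat (2 * p) (2 * p)"
  shows "adjoint_action p U (adjoint_action p V C) = adjoint_action p (U * V) C"
proof -
  have "inv\<^bsub>orth_group p\<^esub> (U * V) = inv\<^bsub>orth_group p\<^esub> V * inv\<^bsub>orth_group p\<^esub> U"
    using group.inv_mult_group[OF group_orth_group U V] by simp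
  then show ?thesis
    unfolding adjoint_action_def
    using C U V inv_orth_group(1)[OF U] inv_orth_group(1)[OF V]
    by (simp add: orth_group_carrier_mat mult_carrier_mat[of _ "2 * p" "2 * p" _ "2 * p"]
        assoc_mult_mat[of _ "2 * p" "2 * p" _ "2 * p" _ "2 * p"])
qed

lemma similar_adjoint_action:
  assumes U: "U \<in> carrier (orth_group p)" and C: "C \<in> carrier_mat (2 * p) (2 * p)"
  shows "similar_mat (adjoint_action p U C) C"
proof (rule similar_matI[of _ _ U "inv\<^bsub>orth_group p\<^esub> U" "2 * p"])
  note c = orth_group_carrier_mat[OF U] orth_group_carrier_mat[OF inv_orth_group(1)[OF U]]
  then show "{adjoint_action p U C, C, U, inv\<^bsub>orth_group p\<^esub> U} \<subseteq> carrier_mat (2 * p) (2 * p)"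
    using C by (auto simp: adjoint_action_def)
qed (use inv_orth_group[OF U] in \<open>auto simp: adjoint_action_def\<close>)

text \<open>
  Orbits are handled directly by the composition law: the maps \<open>C \<mapsto> U C U\<inverse>\<close> are defined on all
  matrices and not only on the set acted upon, so they are not extensional functions, as
  \<^locale>\<open>group_action\<close> would demand.
\<close>

lemma orbit_adjoint_action:
  assumes U: "U \<in> carrier (orth_group p)" and C: "C \<in> carrier_mat (2 * p) (2 * p)"
  shows "orbit (orth_group p) (adjoint_action p) (adjoint_action p U C) =
         orbit (orth_group p) (adjoint_action p) C"
proof (intro equalityI subsetI)
  fix X assume "X \<in> orbit (orth_group p) (adjoint_action p) (adjoint_action p U C)"
  then obtain g where g: "g \<in> carrier (orth_group p)" "X = adjoint_action p g (adjoint_action p U C)"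
    unfolding orbit_def by blast
  have "g * U \<in> carrier (orth_group p)" using group.subgroup_self group_orth_group g(1) U
    by (metis monoid.m_closed group.is_monoid mult_orth_group)
  then show "X \<in> orbit (orth_group p) (adjoint_action p) C"
    unfolding orbit_def using g adjoint_action_mult[OF g(1) U C] by auto
next
  fix X assume "X \<in> orbit (orth_group p) (adjoint_action p) C"
  then obtain g where g: "g \<in> carrier (orth_group p)" "X = adjoint_action p g C"
    unfolding orbit_def by blast
  let ?h = "g * inv\<^bsub>orth_group p\<^esub> U"
  have h: "?h \<in> carrier (orth_group p)" using group_orth_group g(1) inv_orth_group(1)[OF U]
    by (metis monoid.m_closed group.is_monoid mult_orth_group)
  have "?h * U = g"
    using assoc_mult_mat[OF orth_group_carrier_mat[OF g(1)]
        orth_group_carrier_mat[OF inv_orth_group(1)[OF U]] orth_group_carrier_mat[OF U]]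
      inv_orth_group(3)[OF U] right_mult_one_mat[OF orth_group_carrier_mat[OF g(1)]] by simp
  then have "X = adjoint_action p ?h (adjoint_action p U C)"
    using adjoint_action_mult[OF h U C] g(2) by simp
  then show "X \<in> orbit (orth_group p) (adjoint_action p) (adjoint_action p U C)"
    unfolding orbit_def using h by blast
qed

section \<open>Orthogonal conjugacy to a hyperbolic normal form\<close>

text \<open>
  The function \<open>r\<close> ranks the indices so that the off-diagonal entries in row \<open>i\<close> of \<open>A\<close> sit in columns of
  smaller rank. Then the equation at \<open>(i, j)\<close>, given that all entries of \<open>X\<close> of smaller total rank vanish,
  reads \<open>(A i i + A j j) X i j = 0\<close>. The rank covers lower triangular matrices (\<open>r i = i\<close>) and upper
  triangular ones (\<open>r i = n - i\<close>) at once.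
\<close>

lemma triangular_sylvester:
  fixes A X :: "'a :: field mat" and r :: "nat \<Rightarrow> nat"
  assumes A: "A \<in> carrier_mat n n" and X: "X \<in> carrier_mat n n"
    and tri: "\<And>i k. i < n \<Longrightarrow> k < n \<Longrightarrow> k \<noteq> i \<Longrightarrow> \<not> r k < r i \<Longrightarrow> A $$ (i, k) = 0"
    and diag: "\<And>i j. i < n \<Longrightarrow> j < n \<Longrightarrow> A $$ (i, i) + A $$ (j, j) \<noteq> 0"
    and eq: "A * X + X * A\<^sup>T = 0\<^sub>m n n"
  shows "X = 0\<^sub>m n n"
proof -
  have "X $$ (i, j) = 0" if "i < n" "j < n" for i j
    using that
  proof (induction "r i + r j" arbitrary: i j rule: less_induct)
    case less
    have "(A * X) $$ (i, j) = (\<Sum>k = 0..<n. A $$ (i, k) * X $$ (k, j))"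
      using less.prems A X by (auto simp: scalar_prod_def intro!: sum.cong)
    also have "\<dots> = (\<Sum>k = 0..<n. if k = i then A $$ (i, i) * X $$ (i, j) else 0)"
      using less.prems less.hyps[of _ j] tri[of i] by (intro sum.cong) auto
    finally have 1: "(A * X) $$ (i, j) = A $$ (i, i) * X $$ (i, j)" using less.prems by simp
    have "(X * A\<^sup>T) $$ (i, j) = (\<Sum>k = 0..<n. X $$ (i, k) * A $$ (j, k))"
      using less.prems A X by (auto simp: scalar_prod_def intro!: sum.cong)
    also have "\<dots> = (\<Sum>k = 0..<n. if k = j then A $$ (j, j) * X $$ (i, j) else 0)"
      using less.prems less.hyps[of i] tri[of j] by (intro sum.cong) auto
    finally have 2: "(X * A\<^sup>T) $$ (i, j) = A $$ (j, j) * X $$ (i, j)" using less.prems by simp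
    have "(A * X + X * A\<^sup>T) $$ (i, j) = (A * X) $$ (i, j) + (X * A\<^sup>T) $$ (i, j)"
      using less.prems A X by (intro index_add_mat) auto
    then have "(A $$ (i, i) + A $$ (j, j)) * X $$ (i, j) = 0"
      unfolding eq 1 2 using less.prems by (simp add: algebra_simps)
    then show ?case using diag[OF less.prems] by simp
  qed
  then show ?thesis using X by (intro eq_matI) auto
qed

lemma four_block_mat_inject:
  assumes "A \<in> carrier_mat n1 m1" "B \<in> carrier_mat n1 m2" "C \<in> carrier_mat n2 m1" "D \<in> carrier_mat n2 m2"
    and "A' \<in> carrier_mat n1 m1" "B' \<in> carrier_mat n1 m2" "C' \<in> carrier_mat n2 m1" "D' \<in> carrier_mat n2 m2"
    and eq: "four_block_mat A B C D = four_block_mat A' B' C' D'"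
  shows "A = A'" "B = B'" "C = C'" "D = D'"
proof -
  have *: "four_block_mat A B C D $$ (i, j) = four_block_mat A' B' C' D' $$ (i, j)" for i j
    unfolding eq ..
  show "A = A'"
  proof (rule eq_matI)
    fix i j assume "i < dim_row A'" "j < dim_col A'"
    then show "A $$ (i, j) = A' $$ (i, j)" using *[of i j] assms(1-8) by simp
  qed (use assms in auto)
  show "B = B'"
  proof (rule eq_matI)
    fix i j assume "i < dim_row B'" "j < dim_col B'"
    then show "B $$ (i, j) = B' $$ (i, j)" using *[of i "m1 + j"] assms(1-8) by simp
  qed (use assms in auto)
  show "C = C'"
  proof (rule eq_matI)
    fix i j assume "i < dim_row C'" "j < dim_col C'"
    then show "C $$ (i, j) = C' $$ (i, j)" using *[of "n1 + i" j] assms(1-8) by simp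
  qed (use assms in auto)
  show "D = D'"
  proof (rule eq_matI)
    fix i j assume "i < dim_row D'" "j < dim_col D'"
    then show "D $$ (i, j) = D' $$ (i, j)" using *[of "n1 + i" "m1 + j"] assms(1-8) by simp
  qed (use assms in auto)
qed

text \<open>
  The skew map that acts by \<open>J\<close> on the span of the \<open>E\<close>'s and, as skewness forces, by \<open>- J\<^sup>T\<close> on the
  span of the \<open>F\<close>'s.
\<close>

definition hyperbolic :: "complex mat \<Rightarrow> complex mat" where
  "hyperbolic J = four_block_mat J (0\<^sub>m (dim_row J) (dim_row J)) (0\<^sub>m (dim_row J) (dim_row J)) (- J\<^sup>T)"

lemma hyperbolic_in_orth_lie_algebra:
  assumes J: "J \<in> carrier_mat p p"
  shows "hyperbolic J \<in> orth_lie_algebra p"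
proof -
  have JT: "J\<^sup>T \<in> carrier_mat p p" using J by simp
  have H: "hyperbolic J = four_block_mat J (0\<^sub>m p p) (0\<^sub>m p p) (- J\<^sup>T)"
    using J by (simp add: hyperbolic_def)
  have HT: "(hyperbolic J)\<^sup>T = four_block_mat J\<^sup>T (0\<^sub>m p p) (0\<^sub>m p p) (- J)"
    unfolding H by (rule eq_matI) (use J in auto)
  have 1: "(hyperbolic J)\<^sup>T * gram p = four_block_mat (0\<^sub>m p p) J\<^sup>T (- J) (0\<^sub>m p p)"
    unfolding HT gram_def using J JT by (subst mult_four_block_mat[of _ p p _ p _ p _ _ p _ p]) auto
  have 2: "gram p * hyperbolic J = four_block_mat (0\<^sub>m p p) (- J\<^sup>T) J (0\<^sub>m p p)"
    unfolding H gram_def using J JT by (subst mult_four_block_mat[of _ p p _ p _ p _ _ p _ p]) auto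
  have "(hyperbolic J)\<^sup>T * gram p = - (gram p * hyperbolic J)"
    unfolding 1 2 by (rule eq_matI) (use J in auto)
  moreover have "hyperbolic J \<in> carrier_mat (2 * p) (2 * p)"
    unfolding H by (rule carrier_matI) (use J in auto)
  ultimately show ?thesis by (simp add: orth_lie_algebra_iff)
qed

text \<open>
  Here the condition on the diagonal of \<open>J\<close> says that no eigenvalue of \<open>J\<close> is the negative of another one
  or zero. It makes \<open>P\<^sup>T G P\<close> pair the two invariant halves of \<open>D\<close> with each other only, so
  that the similarity \<open>P\<close> needs to be corrected just by an automorphism of \<open>D\<close> acting on one half.
\<close>

lemma orth_conjugate_hyperbolic:
  assumes C: "C \<in> orth_lie_algebra p" and J: "J \<in> carrier_mat p p"
    and tri: "upper_triangular J"
    and diag: "\<And>i j. i < p \<Longrightarrow> j < p \<Longrightarrow> J $$ (i, i) + J $$ (j, j) \<noteq> 0"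
    and sim: "similar_mat C (hyperbolic J)"
  shows "\<exists>U\<in>carrier (orth_group p). C = adjoint_action p U (hyperbolic J)"
proof -
  let ?n = "2 * p" and ?G = "gram p" and ?D = "hyperbolic J"
  note assoc = assoc_mult_mat[of _ ?n ?n _ ?n _ ?n]
  note closed = mult_carrier_mat[of _ ?n ?n _ ?n]
  note block_mult = mult_four_block_mat[of _ p p _ p _ p _ _ p _ p]
  from C have Cc: "C \<in> carrier_mat ?n ?n" and skew: "C\<^sup>T * ?G = - (?G * C)"
    by (auto simp: orth_lie_algebra_iff)
  obtain P Q where "similar_mat_wit C ?D P Q" using sim unfolding similar_mat_def by blast
  note w = similar_mat_witD2[OF Cc this]
  have PT: "P\<^sup>T \<in> carrier_mat ?n ?n" and QT: "Q\<^sup>T \<in> carrier_mat ?n ?n"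
    and CT: "C\<^sup>T \<in> carrier_mat ?n ?n" and DT: "?D\<^sup>T \<in> carrier_mat ?n ?n"
    using w(4-7) by auto
  note c = w(4-7) PT QT CT DT gram_carrier[of p]
  have CP: "C * P = P * ?D"
  proof -
    have "C * P = (P * ?D) * (Q * P)" unfolding w(3) using c by (simp add: assoc closed)
    then show ?thesis using w(2) right_mult_one_mat[OF closed[OF w(6,5)]] by simp
  qed
  define G' where "G' = P\<^sup>T * (?G * P)"
  have G': "G' \<in> carrier_mat ?n ?n" unfolding G'_def using c by (simp add: closed)
  have sym: "G'\<^sup>T = G'"
    unfolding G'_def using c by (simp add: transpose_mult[of _ ?n ?n _ ?n] closed assoc)
  have skew': "?D\<^sup>T * G' = - (G' * ?D)"
  proof -
    have "?D\<^sup>T * G' = (P * ?D)\<^sup>T * (?G * P)"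
      unfolding G'_def transpose_mult[OF w(6,5)] using c by (simp add: assoc closed)
    also have "\<dots> = P\<^sup>T * ((C\<^sup>T * ?G) * P)"
      unfolding CP[symmetric] transpose_mult[OF w(4,6)] using c by (simp add: assoc closed)
    also have "\<dots> = - (P\<^sup>T * (?G * (C * P)))"
    proof -
      have GC: "?G * C \<in> carrier_mat ?n ?n" and GCP: "?G * C * P \<in> carrier_mat ?n ?n"
        using c by (auto simp: closed)
      have "- (?G * C) * P = - (?G * C * P)"
        by (rule uminus_mult_left_mat) (use GC w(6) in auto)
      then have "P\<^sup>T * (- (?G * C) * P) = - (P\<^sup>T * (?G * C * P))"
        using uminus_mult_right_mat[of "P\<^sup>T" "?G * C * P"] GCP PT by auto
      also have "?G * C * P = ?G * (C * P)" by (rule assoc) (use c in auto)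
      finally show ?thesis unfolding skew .
    qed
    also have "P\<^sup>T * (?G * (C * P)) = G' * ?D"
      unfolding CP G'_def using c by (simp add: assoc closed)
    finally show ?thesis .
  qed
  \<comment> \<open>\<open>H\<close> inverts \<open>G'\<close>; its lower left block will be the inverse of \<open>Y\<close>.\<close>
  define H where "H = Q * (?G * Q\<^sup>T)"
  have Hc: "H \<in> carrier_mat ?n ?n" unfolding H_def using c by (simp add: closed)
  have G'H: "G' * H = 1\<^sub>m ?n"
  proof -
    have "G' * H = P\<^sup>T * (?G * ((P * Q) * (?G * Q\<^sup>T)))"
      unfolding G'_def H_def using c by (simp add: assoc closed)
    also have "\<dots> = P\<^sup>T * (?G * (?G * Q\<^sup>T))"
      using w(1) left_mult_one_mat[OF closed[OF gram_carrier QT]] by simp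
    also have "?G * (?G * Q\<^sup>T) = (?G * ?G) * Q\<^sup>T"
      by (rule assoc[symmetric, OF gram_carrier gram_carrier QT])
    also have "P\<^sup>T * \<dots> = (Q * P)\<^sup>T"
      unfolding transpose_mult[OF w(7,6)] using left_mult_one_mat[OF QT] by simp
    finally show ?thesis using w(2) by simp
  qed
  obtain X Y Y' Z where "split_block G' p p = (X, Y, Y', Z)" by (metis prod_cases4)
  from split_block[OF this, of p p] G'
  have XYZ: "X \<in> carrier_mat p p" "Y \<in> carrier_mat p p" "Y' \<in> carrier_mat p p" "Z \<in> carrier_mat p p"
    and G'_eq: "G' = four_block_mat X Y Y' Z" by auto
  obtain H1 H2 K H4 where "split_block H p p = (H1, H2, K, H4)" by (metis prod_cases4)
  from split_block[OF this, of p p] Hc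
  have HK: "H1 \<in> carrier_mat p p" "H2 \<in> carrier_mat p p" "K \<in> carrier_mat p p" "H4 \<in> carrier_mat p p"
    and H_eq: "H = four_block_mat H1 H2 K H4" by auto
  have JT: "J\<^sup>T \<in> carrier_mat p p" and YT: "Y\<^sup>T \<in> carrier_mat p p" and KT: "K\<^sup>T \<in> carrier_mat p p"
    using J XYZ HK by auto
  have D_eq: "?D = four_block_mat J (0\<^sub>m p p) (0\<^sub>m p p) (- J\<^sup>T)"
    using J by (simp add: hyperbolic_def)
  have DT_eq: "?D\<^sup>T = four_block_mat J\<^sup>T (0\<^sub>m p p) (0\<^sub>m p p) (- J)"
    unfolding D_eq by (rule eq_matI) (use J in auto)
  have Y': "Y' = Y\<^sup>T"
  proof -
    have "four_block_mat X\<^sup>T Y'\<^sup>T Y\<^sup>T Z\<^sup>T = four_block_mat X Y Y' Z"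
      using sym unfolding G'_eq transpose_four_block_mat[OF XYZ] .
    from four_block_mat_inject(3)[OF _ _ _ _ _ _ _ _ this, of p p p p] XYZ show ?thesis by auto
  qed
  have DTG: "?D\<^sup>T * G' = four_block_mat (J\<^sup>T * X) (J\<^sup>T * Y) (- (J * Y')) (- (J * Z))"
    unfolding DT_eq G'_eq using J JT XYZ by (subst block_mult) auto
  have GD: "- (G' * ?D) = four_block_mat (- (X * J)) (Y * J\<^sup>T) (- (Y' * J)) (Z * J\<^sup>T)"
  proof -
    have "G' * ?D = four_block_mat (X * J) (- (Y * J\<^sup>T)) (Y' * J) (- (Z * J\<^sup>T))"
      unfolding D_eq G'_eq using J JT XYZ by (subst block_mult) auto
    then show ?thesis by (simp, intro eq_matI) (use J JT XYZ in auto)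
  qed
  have "J\<^sup>T * X = - (X * J)" "J\<^sup>T * Y = Y * J\<^sup>T" "- (J * Z) = Z * J\<^sup>T"
    using four_block_mat_inject(1,2,4)[OF _ _ _ _ _ _ _ _ skew'[unfolded DTG GD], of p p p p]
      J JT XYZ by auto
  note eqs = this
  have "X = 0\<^sub>m p p"
  proof (rule triangular_sylvester[of "J\<^sup>T" p X "\<lambda>i. i"])
    show "J\<^sup>T * X + X * (J\<^sup>T)\<^sup>T = 0\<^sub>m p p" unfolding eqs using J XYZ by auto
    show "J\<^sup>T $$ (i, k) = 0" if "i < p" "k < p" "k \<noteq> i" "\<not> k < i" for i k
      using that J tri by (auto simp: upper_triangular_def)
  qed (use J XYZ diag in auto)
  moreover have "Z = 0\<^sub>m p p"
  proof (rule triangular_sylvester[of J p Z "\<lambda>i. p - i"])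
    show "J * Z + Z * J\<^sup>T = 0\<^sub>m p p" unfolding eqs(3)[symmetric] using J XYZ by auto
    show "J $$ (i, k) = 0" if "i < p" "k < p" "k \<noteq> i" "\<not> p - k < p - i" for i k
      using that J tri by (auto simp: upper_triangular_def)
  qed (use J XYZ diag in auto)
  ultimately have G'_anti: "G' = four_block_mat (0\<^sub>m p p) Y Y\<^sup>T (0\<^sub>m p p)"
    unfolding G'_eq Y' by simp
  have YK: "Y * K = 1\<^sub>m p"
  proof -
    have "G' * H = four_block_mat (Y * K) (Y * H4) (Y\<^sup>T * H1) (Y\<^sup>T * H2)"
      unfolding G'_anti H_eq using XYZ YT HK by (subst block_mult) auto
    then have "four_block_mat (Y * K) (Y * H4) (Y\<^sup>T * H1) (Y\<^sup>T * H2) =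
        four_block_mat (1\<^sub>m p) (0\<^sub>m p p) (0\<^sub>m p p) (1\<^sub>m p)"
      using G'H by (simp add: mult_2)
    from four_block_mat_inject(1)[OF _ _ _ _ _ _ _ _ this, of p p p p] XYZ YT HK show ?thesis by auto
  qed
  have KY: "K * Y = 1\<^sub>m p" by (rule mat_mult_left_right_inverse[OF XYZ(2) HK(3) YK])
  have comm: "K * J\<^sup>T = J\<^sup>T * K"
  proof -
    have "K * J\<^sup>T = K * (J\<^sup>T * (Y * K))" using YK right_mult_one_mat[OF JT] by simp
    also have "\<dots> = K * ((J\<^sup>T * Y) * K)" using assoc_mult_mat[OF JT XYZ(2) HK(3)] by simp
    also have "\<dots> = (K * Y) * (J\<^sup>T * K)"
      unfolding eqs(2) using XYZ HK JT
      by (simp add: assoc_mult_mat[of _ p p _ p _ p] mult_carrier_mat[of _ p p _ p])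
    finally show ?thesis using KY left_mult_one_mat[OF mult_carrier_mat[OF JT HK(3)]] by simp
  qed
  \<comment> \<open>The correction acts as the identity on one half and by \<open>K = Y\<inverse>\<close> on the other.\<close>
  define R where "R = four_block_mat (1\<^sub>m p) (0\<^sub>m p p) (0\<^sub>m p p) K"
  have R: "R \<in> carrier_mat ?n ?n" unfolding R_def by (rule carrier_matI) (use HK in auto)
  have RT_eq: "R\<^sup>T = four_block_mat (1\<^sub>m p) (0\<^sub>m p p) (0\<^sub>m p p) K\<^sup>T"
    unfolding R_def by (rule eq_matI) (use HK in auto)
  have RT: "R\<^sup>T \<in> carrier_mat ?n ?n" using R by simp
  have RD: "R * ?D = ?D * R"
  proof -
    have "R * ?D = four_block_mat J (0\<^sub>m p p) (0\<^sub>m p p) (- (K * J\<^sup>T))"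
      unfolding R_def D_eq using HK J JT by (subst block_mult) auto
    moreover have "?D * R = four_block_mat J (0\<^sub>m p p) (0\<^sub>m p p) (- (J\<^sup>T * K))"
      unfolding R_def D_eq using HK J JT by (subst block_mult) auto
    ultimately show ?thesis unfolding comm by simp
  qed
  have RGR: "R\<^sup>T * (G' * R) = ?G"
  proof -
    have 1: "G' * R = four_block_mat (0\<^sub>m p p) (Y * K) Y\<^sup>T (0\<^sub>m p p)"
      unfolding R_def G'_anti using HK XYZ YT by (subst block_mult) auto
    have 2: "K\<^sup>T * Y\<^sup>T = 1\<^sub>m p"
      using transpose_mult[OF XYZ(2) HK(3)] YK by simp
    have "R\<^sup>T * (G' * R) = four_block_mat (0\<^sub>m p p) (Y * K) (K\<^sup>T * Y\<^sup>T) (0\<^sub>m p p)"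
      unfolding 1 RT_eq using HK XYZ YT KT by (subst block_mult) auto
    then show ?thesis unfolding YK 2 gram_def .
  qed
  define U where "U = P * R"
  have Uc: "U \<in> carrier_mat ?n ?n" unfolding U_def using c R by (simp add: closed)
  have "U\<^sup>T * ?G * U = R\<^sup>T * (G' * R)"
    unfolding U_def G'_def transpose_mult[OF w(6) R] using c R RT by (simp add: assoc closed)
  then have U: "U \<in> carrier (orth_group p)" using Uc RGR by (simp add: carrier_orth_group_iff)
  have CU: "C * U = U * ?D"
  proof -
    have "C * U = (C * P) * R" unfolding U_def using c R by (simp add: assoc closed)
    also have "\<dots> = P * (?D * R)" unfolding CP using c R by (simp add: assoc closed)
    also have "\<dots> = U * ?D" unfolding RD[symmetric] U_def using c R by (simp add: assoc closed)
    finally show ?thesis .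
  qed
  have "adjoint_action p U ?D = C * (U * inv\<^bsub>orth_group p\<^esub> U)"
    unfolding adjoint_action_def CU[symmetric]
    by (rule assoc[OF Cc Uc orth_group_carrier_mat[OF inv_orth_group(1)[OF U]]])
  then have "C = adjoint_action p U ?D"
    using inv_orth_group(2)[OF U] right_mult_one_mat[OF Cc] by simp
  with U show ?thesis by blast
qed

section \<open>The symmetry of the triple\<close>

lemma invertible_mat_iff_not_eigenvalue_0:
  fixes A :: "'a :: field mat"
  assumes A: "A \<in> carrier_mat n n"
  shows "invertible_mat A \<longleftrightarrow> \<not> eigenvalue A 0"
proof -
  have "char_matrix A 0 = A" unfolding char_matrix_def by (rule eq_matI) (use A in auto)
  then have ev: "eigenvalue A 0 \<longleftrightarrow> det A = 0" using eigenvalue_det[OF A, of 0] by simp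
  show ?thesis
  proof
    assume "invertible_mat A"
    then obtain B where AB: "A * B = 1\<^sub>m n" "B * A = 1\<^sub>m (dim_row B)"
      using A unfolding invertible_mat_def inverts_mat_def by auto
    have B: "B \<in> carrier_mat n n"
      using arg_cong[OF AB(1), of dim_col] arg_cong[OF AB(2), of dim_col] A by (intro carrier_matI) auto
    have "det A * det B = 1" using det_mult[OF A B] AB(1) by simp
    then show "\<not> eigenvalue A 0" using ev by auto
  next
    assume "\<not> eigenvalue A 0"
    then have "A \<in> Units (ring_mat TYPE('a) n ())" using det_non_zero_imp_unit[OF A] ev by auto
    then obtain B where "B \<in> carrier_mat n n" "B * A = 1\<^sub>m n" "A * B = 1\<^sub>m n"
      unfolding Units_def ring_mat_simps by blast
    then show "invertible_mat A" using A unfolding invertible_mat_def inverts_mat_def by auto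
  qed
qed

lemma inv_skew_iff:
  "C \<in> inv_skew p \<longleftrightarrow> C \<in> orth_lie_algebra p \<and> \<not> eigenvalue C 0"
  unfolding inv_skew_def using invertible_mat_iff_not_eigenvalue_0
  by (auto simp: orth_lie_algebra_def)

lemma inv_skew_carrier_mat: "C \<in> inv_skew p \<Longrightarrow> C \<in> carrier_mat (2 * p) (2 * p)"
  by (simp add: inv_skew_def orth_lie_algebra_def)

lemma complex_jordan_nf_exists:
  fixes C :: "complex mat"
  assumes "C \<in> carrier_mat n n"
  shows "\<exists>xs. jordan_nf C xs"
  using char_poly_factorized[OF assms] jordan_nf_exists[OF assms] by metis

lemma jordan_triple_similar:
  assumes A: "A \<in> carrier_mat n n" and B: "B \<in> carrier_mat n n" and sim: "similar_mat A B"
  shows "jordan_triple A = jordan_triple B"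
proof -
  obtain xs where xs: "jordan_nf B xs" using complex_jordan_nf_exists[OF B] by blast
  show ?thesis
    unfolding jordan_triple_of_jordan_nf[OF B xs]
    by (rule jordan_triple_of_jordan_nf[OF A jordan_nf_similar[OF sim xs]])
qed

lemma similar_uminus_transpose:
  fixes A B :: "'a :: comm_ring_1 mat"
  assumes A: "A \<in> carrier_mat n n" and sim: "similar_mat A B"
  shows "similar_mat (- A\<^sup>T) (- B\<^sup>T)"
proof -
  obtain P Q where "similar_mat_wit A B P Q" using sim unfolding similar_mat_def by blast
  note w = similar_mat_witD2[OF A this]
  have QB: "Q\<^sup>T * B\<^sup>T \<in> carrier_mat n n" using w by auto
  have "A\<^sup>T = Q\<^sup>T * (B\<^sup>T * P\<^sup>T)"
    unfolding w(3) transpose_mult[OF mult_carrier_mat[OF w(6,5)] w(7)] transpose_mult[OF w(6,5)] ..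
  also have "\<dots> = Q\<^sup>T * B\<^sup>T * P\<^sup>T" by (rule assoc_mult_mat[symmetric]) (use w in auto)
  finally have AT: "A\<^sup>T = Q\<^sup>T * B\<^sup>T * P\<^sup>T" .
  have "Q\<^sup>T * - B\<^sup>T = - (Q\<^sup>T * B\<^sup>T)" by (rule uminus_mult_right_mat) (use w in auto)
  moreover have "- (Q\<^sup>T * B\<^sup>T) * P\<^sup>T = - (Q\<^sup>T * B\<^sup>T * P\<^sup>T)"
    by (rule uminus_mult_left_mat) (use w in auto)
  ultimately have "- A\<^sup>T = Q\<^sup>T * - B\<^sup>T * P\<^sup>T" unfolding AT by simp
  moreover have "Q\<^sup>T * P\<^sup>T = 1\<^sub>m n" "P\<^sup>T * Q\<^sup>T = 1\<^sub>m n"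
    unfolding transpose_mult[OF w(6,7), symmetric] transpose_mult[OF w(7,6), symmetric] w(1,2)
    by simp_all
  ultimately show ?thesis
    by (intro similar_matI[of _ _ "Q\<^sup>T" "P\<^sup>T" n]) (use w in auto)
qed

text \<open>Skewness \<open>C\<^sup>T G = - G C\<close> and \<open>G\<^sup>2 = 1\<close> give \<open>C = G (- C\<^sup>T) G\<close>, so \<open>C\<close> is similar to \<open>- C\<^sup>T\<close>.\<close>

lemma orth_lie_algebra_jordan_nf_symmetric:
  assumes C: "C \<in> orth_lie_algebra p" and jnf: "jordan_nf C xs"
  shows "mset (negate_blocks xs) = mset xs"
proof -
  let ?n = "2 * p" and ?G = "gram p"
  have Cc: "C \<in> carrier_mat ?n ?n" and skew: "C\<^sup>T * ?G = - (?G * C)"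
    using C by (auto simp: orth_lie_algebra_iff)
  have CT: "C\<^sup>T \<in> carrier_mat ?n ?n" using Cc by simp
  have GC: "?G * C \<in> carrier_mat ?n ?n" using mult_carrier_mat[OF gram_carrier Cc] .
  have "?G * (- C\<^sup>T) * ?G = C"
  proof -
    have "?G * (- C\<^sup>T) * ?G = ?G * (- C\<^sup>T * ?G)"
      by (rule assoc_mult_mat) (use CT in auto)
    also have "- C\<^sup>T * ?G = - (C\<^sup>T * ?G)" by (rule uminus_mult_left_mat) (use CT in auto)
    also have "\<dots> = ?G * C" unfolding skew using GC by auto
    also have "?G * (?G * C) = (?G * ?G) * C"
      by (rule assoc_mult_mat[symmetric, OF gram_carrier gram_carrier Cc])
    finally show ?thesis using left_mult_one_mat[OF Cc] by simp
  qed
  then have 1: "similar_mat C (- C\<^sup>T)"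
    by (intro similar_matI[of _ _ ?G ?G ?n]) (use Cc in auto)
  have 2: "similar_mat (- C\<^sup>T) (- (jordan_matrix xs)\<^sup>T)"
    by (rule similar_uminus_transpose[OF Cc]) (use jnf in \<open>simp add: jordan_nf_def\<close>)
  have "similar_mat C (jordan_matrix (negate_blocks xs))"
    by (rule similar_mat_trans[OF 1 similar_mat_trans[OF 2 similar_uminus_transpose_jordan_matrix]])
  moreover have "0 \<notin> fst ` set (negate_blocks xs)"
    using jnf unfolding jordan_nf_def by (metis list.set_map map_fst_negate_blocks)
  ultimately have "jordan_nf C (negate_blocks xs)" by (simp add: jordan_nf_def)
  from jordan_nf_unique_mset[OF this jnf] show ?thesis .
qed

lemma count_blocks: "count (mset xs) (k, \<mu>) = count (mset (blocks_at xs \<mu>)) k"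
  by (induction xs) (auto simp: blocks_at_def)

lemma blocks_at_cong_mset: "mset xs = mset ys \<Longrightarrow> mset (blocks_at xs \<mu>) = mset (blocks_at ys \<mu>)"
  unfolding blocks_at_def mset_map mset_filter by simp

lemma blocks_at_eq_Nil_iff: "blocks_at xs \<mu> = [] \<longleftrightarrow> \<mu> \<notin> snd ` set xs"
  by (force simp: blocks_at_def filter_empty_conv)

lemma mset_eq_if_blocks_at:
  fixes xs ys :: "(nat \<times> 'a) list"
  assumes "snd ` set xs = snd ` set ys"
    and "\<And>\<mu>. \<mu> \<in> snd ` set ys \<Longrightarrow> mset (blocks_at xs \<mu>) = mset (blocks_at ys \<mu>)"
  shows "mset xs = mset ys"
proof (rule multiset_eqI)
  fix x :: "nat \<times> 'a"
  obtain k \<mu> where x: "x = (k, \<mu>)" by force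
  show "count (mset xs) x = count (mset ys) x"
  proof (cases "\<mu> \<in> snd ` set ys")
    case True
    then show ?thesis using assms(2) unfolding x count_blocks by simp
  next
    case False
    then have "blocks_at xs \<mu> = []" "blocks_at ys \<mu> = []"
      using assms(1) by (simp_all add: blocks_at_eq_Nil_iff)
    then show ?thesis unfolding x count_blocks by simp
  qed
qed

lemma sum_blocks_at:
  assumes "finite \<Lambda>" "snd ` set xs \<subseteq> \<Lambda>"
  shows "(\<Sum>\<mu>\<in>\<Lambda>. sum_list (blocks_at xs \<mu>)) = sum_list (map fst xs)"
  using assms(2)
proof (induction xs)
  case (Cons x xs)
  have "(\<Sum>\<mu>\<in>\<Lambda>. sum_list (blocks_at (x # xs) \<mu>)) =
      (\<Sum>\<mu>\<in>\<Lambda>. (if \<mu> = snd x then fst x else 0) + sum_list (blocks_at xs \<mu>))"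
    by (intro sum.cong) (auto simp: blocks_at_def)
  then show ?case using Cons assms(1) by (simp add: sum.distrib)
qed (simp add: blocks_at_def)

lemma blocks_at_negate_blocks:
  fixes xs :: "(nat \<times> 'a :: group_add) list"
  shows "blocks_at (negate_blocks xs) \<mu> = blocks_at xs (- \<mu>)"
  by (induction xs) (auto simp: blocks_at_def negate_blocks_def)

lemma jordan_triple_in_index_set:
  assumes C: "C \<in> inv_skew p"
  shows "jordan_triple C \<in> index_set p"
proof -
  note Cc = inv_skew_carrier_mat[OF C]
  have lie: "C \<in> orth_lie_algebra p" and ev: "\<not> eigenvalue C 0" using C by (auto simp: inv_skew_iff)
  obtain xs where jnf: "jordan_nf C xs" using complex_jordan_nf_exists[OF Cc] by blast
  have pos: "\<And>x. x \<in> set xs \<Longrightarrow> 1 \<le> fst x"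
    using jnf unfolding jordan_nf_def by (metis image_eqI less_one not_le)
  let ?\<Lambda> = "snd ` set xs"
  note sym = orth_lie_algebra_jordan_nf_symmetric[OF lie jnf]
  have blocks_sym: "mset (blocks_at xs (- \<mu>)) = mset (blocks_at xs \<mu>)" for \<mu>
    using blocks_at_cong_mset[OF sym, of \<mu>] by (simp add: blocks_at_negate_blocks)
  have \<Lambda>_sym: "\<mu> \<in> ?\<Lambda> \<longleftrightarrow> - \<mu> \<in> ?\<Lambda>" for \<mu>
    using blocks_sym[of \<mu>] blocks_at_eq_Nil_iff[of xs \<mu>] blocks_at_eq_Nil_iff[of xs "- \<mu>"] by auto
  have sum_sym: "sum_list (blocks_at xs (- \<mu>)) = sum_list (blocks_at xs \<mu>)" for \<mu>
    using blocks_sym[of \<mu>] by (metis sum_mset_sum_list)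
  have sort_sym: "sort (blocks_at xs (- \<mu>)) = sort (blocks_at xs \<mu>)" for \<mu>
    using blocks_sym[of \<mu>] by (metis sorted_list_of_multiset_mset)
  have block_pos: "1 \<le> k" if "k \<in> set (blocks_at xs \<mu>)" for k \<mu>
    using that pos by (auto simp: blocks_at_def)
  have sum_pos: "1 \<le> sum_list (blocks_at xs \<mu>)" if "\<mu> \<in> ?\<Lambda>" for \<mu>
  proof -
    have "blocks_at xs \<mu> \<noteq> []" using that by (simp add: blocks_at_eq_Nil_iff)
    then obtain k where "k \<in> set (blocks_at xs \<mu>)" by (meson list.set_sel(1))
    then show ?thesis using block_pos member_le_sum_list[of k "blocks_at xs \<mu>"] by fastforce
  qed
  have sum: "(\<Sum>\<mu>\<in>?\<Lambda>. sum_list (blocks_at xs \<mu>)) = 2 * p"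
  proof -
    have "sum_list (map fst xs) = 2 * p"
      using similar_matD[of C "jordan_matrix xs"] jnf Cc unfolding jordan_nf_def
      by (metis carrier_matD(1) insert_subset jordan_matrix_dim(1))
    then show ?thesis using sum_blocks_at[of ?\<Lambda> xs] by simp
  qed
  have "card ?\<Lambda> \<le> (\<Sum>\<mu>\<in>?\<Lambda>. sum_list (blocks_at xs \<mu>))"
    unfolding card_eq_sum by (rule sum_mono) (rule sum_pos)
  then have "card ?\<Lambda> \<le> 2 * p" unfolding sum .
  moreover have "?\<Lambda> \<subseteq> UNIV - {0}" using ev eigenvalue_iff_jordan_nf[OF Cc jnf] by auto
  moreover have "rev (sort (blocks_at xs \<mu>)) \<in> partitions" if "\<mu> \<in> ?\<Lambda>" for \<mu>
  proof -
    have "blocks_at xs \<mu> \<noteq> []" using that by (simp add: blocks_at_eq_Nil_iff)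
    then have "sort (blocks_at xs \<mu>) \<noteq> []" by (metis set_empty set_sort)
    then show ?thesis using block_pos[of _ \<mu>] by (auto simp: partitions_def sorted_wrt_rev)
  qed
  moreover have "sum_list (rev (sort (blocks_at xs \<mu>))) = sum_list (blocks_at xs \<mu>)" for \<mu>
    by (metis mset_rev mset_sort sum_mset_sum_list)
  ultimately show ?thesis
    unfolding jordan_triple_of_jordan_nf[OF Cc jnf] index_set_def partition_sum_def
    using \<Lambda>_sym sum_sym sort_sym sum_pos sum by simp
qed

section \<open>A normal form for every triple\<close>

text \<open>
  A half of \<open>\<complex> - {0}\<close> that contains exactly one of \<open>\<mu>\<close> and \<open>- \<mu>\<close> and is closed under addition. By the
  latter, no two eigenvalues in it add up to \<open>0\<close>.
\<close>

definition upper_half :: "complex \<Rightarrow> bool" where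
  "upper_half \<mu> \<longleftrightarrow> Re \<mu> > 0 \<or> (Re \<mu> = 0 \<and> Im \<mu> > 0)"

lemma upper_half_add_nonzero: "upper_half a \<Longrightarrow> upper_half b \<Longrightarrow> a + b \<noteq> 0"
  by (auto simp: upper_half_def complex_eq_iff)

lemma upper_half_uminus: "\<mu> \<noteq> 0 \<Longrightarrow> upper_half (- \<mu>) \<longleftrightarrow> \<not> upper_half \<mu>"
  by (auto simp: upper_half_def complex_eq_iff)

text \<open>Any enumeration of the eigenvalues in the half would do, as the order of the blocks is irrelevant.\<close>

definition half_blocks :: "complex set \<Rightarrow> (complex \<Rightarrow> nat list) \<Rightarrow> (nat \<times> complex) list" where
  "half_blocks \<Lambda> d = concat (map (\<lambda>\<mu>. map (\<lambda>k. (k, \<mu>)) (d \<mu>))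
     (SOME ls. distinct ls \<and> set ls = {\<mu>\<in>\<Lambda>. upper_half \<mu>}))"

definition skew_normal_form :: "complex set \<Rightarrow> (complex \<Rightarrow> nat list) \<Rightarrow> complex mat" where
  "skew_normal_form \<Lambda> d = hyperbolic (jordan_matrix (half_blocks \<Lambda> d))"

lemma blocks_at_half_blocks:
  assumes "finite \<Lambda>"
  shows "blocks_at (half_blocks \<Lambda> d) \<mu> = (if \<mu> \<in> \<Lambda> \<and> upper_half \<mu> then d \<mu> else [])"
proof -
  define ls where "ls = (SOME ls. distinct ls \<and> set ls = {\<mu>\<in>\<Lambda>. upper_half \<mu>})"
  have "\<exists>ls. distinct ls \<and> set ls = {\<mu>\<in>\<Lambda>. upper_half \<mu>}"
    using finite_distinct_list[of "{\<mu>\<in>\<Lambda>. upper_half \<mu>}"] assms by auto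
  then have ls: "distinct ls" "set ls = {\<mu>\<in>\<Lambda>. upper_half \<mu>}"
    unfolding ls_def by (metis (mono_tags, lifting) someI_ex)+
  have "blocks_at (concat (map (\<lambda>\<mu>. map (\<lambda>k. (k, \<mu>)) (d \<mu>)) ls)) \<mu> =
      (if \<mu> \<in> set ls then d \<mu> else [])"
    using ls(1)
  proof (induction ls)
    case (Cons \<nu> ls)
    have "filter (\<lambda>x. snd x = \<mu>) (map (\<lambda>k. (k, \<nu>)) (d \<nu>)) = (if \<nu> = \<mu> then map (\<lambda>k. (k, \<nu>)) (d \<nu>) else [])"
      by (auto simp: filter_map o_def)
    then show ?case using Cons by (auto simp: blocks_at_def o_def)
  qed (simp add: blocks_at_def)
  then show ?thesis unfolding half_blocks_def ls_def[symmetric] ls(2) by simp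
qed

lemma jordan_nf_hyperbolic:
  assumes "0 \<notin> fst ` set xs"
  shows "jordan_nf (hyperbolic (jordan_matrix xs)) (xs @ negate_blocks xs)"
proof -
  let ?n = "sum_list (map fst xs)"
  have "similar_mat (four_block_mat (jordan_matrix xs) (0\<^sub>m ?n ?n) (0\<^sub>m ?n ?n) (- (jordan_matrix xs)\<^sup>T))
      (four_block_mat (jordan_matrix xs) (0\<^sub>m ?n ?n) (0\<^sub>m ?n ?n) (jordan_matrix (negate_blocks xs)))"
    by (rule similar_mat_four_block_0_0[OF similar_mat_refl[OF jordan_matrix_carrier]
          similar_uminus_transpose_jordan_matrix]) auto
  then have "similar_mat (hyperbolic (jordan_matrix xs)) (jordan_matrix (xs @ negate_blocks xs))"
    unfolding jordan_matrix_append hyperbolic_def by simp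
  moreover have "0 \<notin> fst ` set (negate_blocks xs)"
    using assms by (metis list.set_map map_fst_negate_blocks)
  ultimately show ?thesis using assms by (auto simp: jordan_nf_def)
qed

text \<open>
  One matrix per triple serves both halves of the bijection: that it realises the triple gives
  surjectivity, and that every element with this triple is conjugate to it gives injectivity.
\<close>

lemma skew_normal_form:
  assumes t: "(\<Lambda>, m, d) \<in> index_set p"
  shows "skew_normal_form \<Lambda> d \<in> inv_skew p"
    and "jordan_triple (skew_normal_form \<Lambda> d) = (\<Lambda>, m, d)"
    and "\<And>C. C \<in> inv_skew p \<Longrightarrow> jordan_triple C = (\<Lambda>, m, d) \<Longrightarrow>
      \<exists>U\<in>carrier (orth_group p). C = adjoint_action p U (skew_normal_form \<Lambda> d)"
proof -
  define xs where "xs = half_blocks \<Lambda> d"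
  let ?J = "jordan_matrix xs" and ?ys = "xs @ negate_blocks xs"
  let ?D = "skew_normal_form \<Lambda> d"
  have D_eq: "?D = hyperbolic ?J" by (simp add: skew_normal_form_def xs_def)
  have fin: "finite \<Lambda>" and nz: "0 \<notin> \<Lambda>" and \<Lambda>_sym: "\<And>\<mu>. \<mu> \<in> \<Lambda> \<longleftrightarrow> - \<mu> \<in> \<Lambda>"
    and mE: "m \<in> \<Lambda> \<rightarrow>\<^sub>E {1..}" and m_sum: "(\<Sum>\<mu>\<in>\<Lambda>. m \<mu>) = 2 * p"
    and dE: "d \<in> \<Lambda> \<rightarrow>\<^sub>E partitions" and d_sym: "\<forall>\<mu>\<in>\<Lambda>. d \<mu> = d (- \<mu>)"
    and dm: "\<And>\<mu>. \<mu> \<in> \<Lambda> \<Longrightarrow> sum_list (d \<mu>) = m \<mu>"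
    using t unfolding index_set_def mem_Collect_eq prod.case partition_sum_def by blast+
  have m: "m \<in> extensional \<Lambda>" using mE by (simp add: PiE_iff)
  have d: "d \<in> extensional \<Lambda>" "\<And>\<mu>. \<mu> \<in> \<Lambda> \<Longrightarrow> d \<mu> \<in> partitions" "\<And>\<mu>. \<mu> \<in> \<Lambda> \<Longrightarrow> d (- \<mu>) = d \<mu>"
    using dE d_sym by (simp_all add: PiE_iff)
  have xs_at: "blocks_at xs \<mu> = (if \<mu> \<in> \<Lambda> \<and> upper_half \<mu> then d \<mu> else [])" for \<mu>
    unfolding xs_def by (rule blocks_at_half_blocks[OF fin])
  have ys_at: "blocks_at ?ys \<mu> = (if \<mu> \<in> \<Lambda> then d \<mu> else [])" for \<mu>
  proof -
    have "blocks_at ?ys \<mu> = blocks_at xs \<mu> @ blocks_at xs (- \<mu>)"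
      using blocks_at_negate_blocks[of xs \<mu>] by (simp add: blocks_at_def)
    then show ?thesis
      using xs_at[of \<mu>] xs_at[of "- \<mu>"] \<Lambda>_sym[of \<mu>] d(3)[of \<mu>] nz upper_half_uminus[of \<mu>]
      by (cases "\<mu> = 0") auto
  qed
  have d_ne: "d \<mu> \<noteq> []" and d_pos: "0 \<notin> set (d \<mu>)" and d_sorted: "rev (sort (d \<mu>)) = d \<mu>"
    if "\<mu> \<in> \<Lambda>" for \<mu>
  proof -
    have "sorted (rev (d \<mu>))" using d(2)[OF that] by (simp add: partitions_def sorted_wrt_rev)
    then have "sort (d \<mu>) = rev (d \<mu>)" by (intro properties_for_sort) auto
    then show "rev (sort (d \<mu>)) = d \<mu>" by simp
  qed (use d(2)[OF that] in \<open>auto simp: partitions_def\<close>)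
  have ys_\<Lambda>: "snd ` set ?ys = \<Lambda>"
    using ys_at d_ne blocks_at_eq_Nil_iff[of ?ys] by (intro Set.set_eqI) metis
  have xs_upper: "upper_half \<mu>" if "\<mu> \<in> snd ` set xs" for \<mu>
    using that xs_at[of \<mu>] blocks_at_eq_Nil_iff[of xs \<mu>] by (metis)
  have xs_pos: "0 \<notin> fst ` set xs"
  proof
    assume "0 \<in> fst ` set xs"
    then obtain \<mu> where "(0, \<mu>) \<in> set xs" by force
    then have "0 \<in> set (blocks_at xs \<mu>)" by (force simp: blocks_at_def)
    then show False using xs_at[of \<mu>] d_pos[of \<mu>] by (auto split: if_splits)
  qed
  note jnf = jordan_nf_hyperbolic[OF xs_pos, folded D_eq]
  have dim: "sum_list (map fst xs) = p"
  proof -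
    have "sum_list (map fst ?ys) = (\<Sum>\<mu>\<in>\<Lambda>. sum_list (blocks_at ?ys \<mu>))"
      by (rule sum_blocks_at[symmetric, OF fin]) (simp only: ys_\<Lambda> order_refl)
    also have "\<dots> = 2 * p" unfolding m_sum[symmetric] by (intro sum.cong) (simp_all add: ys_at dm)
    finally show ?thesis by simp
  qed
  have J: "?J \<in> carrier_mat p p" using jordan_matrix_carrier[of xs] unfolding dim .
  have tri: "upper_triangular ?J" unfolding upper_triangular_def using jordan_matrix_upper_triangular by auto
  have diag: "?J $$ (i, i) + ?J $$ (j, j) \<noteq> 0" if "i < p" "j < p" for i j
  proof -
    have "?J $$ (i, i) \<in> snd ` set xs" if "i < p" for i
      using that dim diagonal_part_entry[of i xs] diagonal_part_index[of i xs i] by simp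
    then show ?thesis using that xs_upper upper_half_add_nonzero by blast
  qed
  have lie: "?D \<in> orth_lie_algebra p" unfolding D_eq by (rule hyperbolic_in_orth_lie_algebra[OF J])
  then have Dc: "?D \<in> carrier_mat (2 * p) (2 * p)" by (simp add: orth_lie_algebra_iff)
  show "?D \<in> inv_skew p"
    unfolding inv_skew_iff eigenvalue_iff_jordan_nf[OF Dc jnf] ys_\<Lambda> using lie nz by simp
  show "jordan_triple ?D = (\<Lambda>, m, d)"
  proof -
    have "restrict (\<lambda>\<mu>. sum_list (blocks_at ?ys \<mu>)) \<Lambda> = m"
      by (rule extensionalityI[OF restrict_extensional m]) (simp add: ys_at dm)
    moreover have "restrict (\<lambda>\<mu>. rev (sort (blocks_at ?ys \<mu>))) \<Lambda> = d"
      by (rule extensionalityI[OF restrict_extensional d(1)]) (simp add: ys_at d_sorted)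
    ultimately show ?thesis unfolding jordan_triple_of_jordan_nf[OF Dc jnf] ys_\<Lambda> by simp
  qed
  fix C assume C: "C \<in> inv_skew p" and trip: "jordan_triple C = (\<Lambda>, m, d)"
  note Cc = inv_skew_carrier_mat[OF C]
  obtain zs where zs: "jordan_nf C zs" using complex_jordan_nf_exists[OF Cc] by blast
  have zs_\<Lambda>: "snd ` set zs = \<Lambda>"
    and zs_d: "restrict (\<lambda>\<mu>. rev (sort (blocks_at zs \<mu>))) \<Lambda> = d"
    using trip unfolding jordan_triple_of_jordan_nf[OF Cc zs] by auto
  have "mset zs = mset ?ys"
  proof (rule mset_eq_if_blocks_at)
    show "snd ` set zs = snd ` set ?ys" unfolding zs_\<Lambda> ys_\<Lambda> ..
    fix \<mu> assume "\<mu> \<in> snd ` set ?ys"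
    then have \<mu>: "\<mu> \<in> \<Lambda>" unfolding ys_\<Lambda> .
    then have "d \<mu> = rev (sort (blocks_at zs \<mu>))" using zs_d by (metis restrict_apply')
    then show "mset (blocks_at zs \<mu>) = mset (blocks_at ?ys \<mu>)" using \<mu> by (simp add: ys_at)
  qed
  then have "jordan_nf C ?ys" by (rule jordan_nf_cong_mset[OF zs])
  then have "similar_mat C ?D"
    using jnf similar_mat_sym similar_mat_trans unfolding jordan_nf_def by blast
  then show "\<exists>U\<in>carrier (orth_group p). C = adjoint_action p U ?D"
    unfolding D_eq using C by (intro orth_conjugate_hyperbolic[OF _ J tri diag]) (auto simp: inv_skew_def)
qed

section \<open>The bijection\<close>

theorem theorem7:
  fixes p :: nat
  assumes "p \<ge> 1"
  shows "jordan_triple \<in> inv_skew p \<rightarrow> index_set p \<and>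
    (\<exists>f. (\<forall>C\<in>inv_skew p. f (orbit (orth_group p) (adjoint_action p) C) = jordan_triple C) \<and>
         bij_betw f (orbits (orth_group p) (inv_skew p) (adjoint_action p)) (index_set p))"
proof (intro conjI)
  show "jordan_triple \<in> inv_skew p \<rightarrow> index_set p" using jordan_triple_in_index_set by blast
next
  let ?orbit = "orbit (orth_group p) (adjoint_action p)"
  \<comment> \<open>Evaluate the triple at a chosen representative; similar matrices have equal triples.\<close>
  define f where "f T = jordan_triple (SOME X. X \<in> T)" for T
  have f: "f (?orbit C) = jordan_triple C" if C: "C \<in> inv_skew p" for C
  proof -
    note Cc = inv_skew_carrier_mat[OF C]
    have "\<one>\<^bsub>orth_group p\<^esub> \<in> carrier (orth_group p)"
      by (rule monoid.one_closed[OF group.is_monoid[OF group_orth_group]])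
    then have "\<exists>X. X \<in> ?orbit C" unfolding orbit_def by blast
    then have "(SOME X. X \<in> ?orbit C) \<in> ?orbit C" by (rule someI_ex)
    then obtain U where U: "U \<in> carrier (orth_group p)"
      and X: "(SOME X. X \<in> ?orbit C) = adjoint_action p U C" unfolding orbit_def by blast
    have sim: "similar_mat (adjoint_action p U C) C" by (rule similar_adjoint_action[OF U Cc])
    then have "adjoint_action p U C \<in> carrier_mat (2 * p) (2 * p)"
      using similar_matD[OF sim] Cc by (metis carrier_matD(1) insert_subset)
    from jordan_triple_similar[OF this Cc sim] show ?thesis unfolding f_def X .
  qed
  have orbit_eq: "?orbit C = ?orbit (skew_normal_form \<Lambda> d)"
    if C: "C \<in> inv_skew p" and trip: "jordan_triple C = (\<Lambda>, m, d)" for C \<Lambda> m d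
  proof -
    have t: "(\<Lambda>, m, d) \<in> index_set p" using jordan_triple_in_index_set[OF C] trip by simp
    from skew_normal_form(3)[OF t C trip] obtain U where
      U: "U \<in> carrier (orth_group p)" "C = adjoint_action p U (skew_normal_form \<Lambda> d)" by blast
    show ?thesis unfolding U(2)
      by (rule orbit_adjoint_action[OF U(1) inv_skew_carrier_mat[OF skew_normal_form(1)[OF t]]])
  qed
  have "bij_betw f (orbits (orth_group p) (inv_skew p) (adjoint_action p)) (index_set p)"
  proof (rule bij_betw_imageI)
    show "inj_on f (orbits (orth_group p) (inv_skew p) (adjoint_action p))"
    proof (rule inj_onI)
      fix T1 T2
      assume "T1 \<in> orbits (orth_group p) (inv_skew p) (adjoint_action p)"
        and "T2 \<in> orbits (orth_group p) (inv_skew p) (adjoint_action p)" and eq: "f T1 = f T2"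
      then obtain C1 C2 where C: "C1 \<in> inv_skew p" "C2 \<in> inv_skew p"
        and T: "T1 = ?orbit C1" "T2 = ?orbit C2" unfolding orbits_def by blast
      obtain \<Lambda> m d where "jordan_triple C1 = (\<Lambda>, m, d)" by (metis prod_cases3)
      moreover from this have "jordan_triple C2 = (\<Lambda>, m, d)" using eq f C T by simp
      ultimately show "T1 = T2" unfolding T using orbit_eq C by metis
    qed
    show "f ` orbits (orth_group p) (inv_skew p) (adjoint_action p) = index_set p"
    proof (intro equalityI subsetI)
      fix t assume "t \<in> f ` orbits (orth_group p) (inv_skew p) (adjoint_action p)"
      then show "t \<in> index_set p" unfolding orbits_def using f jordan_triple_in_index_set by auto
    next
      fix t assume t: "t \<in> index_set p"
      obtain \<Lambda> m d where t_eq: "t = (\<Lambda>, m, d)" by (metis prod_cases3)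
      note D = skew_normal_form(1,2)[OF t[unfolded t_eq]]
      have "f (?orbit (skew_normal_form \<Lambda> d)) = t" using f[OF D(1)] D(2) t_eq by simp
      then show "t \<in> f ` orbits (orth_group p) (inv_skew p) (adjoint_action p)"
        unfolding orbits_def using D(1) by blast
    qed
  qed
  then show "\<exists>f. (\<forall>C\<in>inv_skew p. f (?orbit C) = jordan_triple C) \<and>
      bij_betw f (orbits (orth_group p) (inv_skew p) (adjoint_action p)) (index_set p)"
    using f by blast
qed

end
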